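(* Let $\mathcal{C}$ be a skeletally small abelian Krull-Schmidt category with enough projectives and enough injectives. Then $\mathcal{C}$ is a Frobenius category if and only if $$\Phi_{\mathcal{P}(\mathcal{C})}\mathrm{dim}(\mathcal{C})=\Phi^{\mathcal{I}(\mathcal{C})}\mathrm{dim}(\mathcal{C})=0.$$
   Context: $\mathcal{P}(\mathcal{C})$ and $\mathcal{I}(\mathcal{C})$ are the classes of projective and injective objects of $\mathcal{C}$. Krull-Schmidt: each object is a finite direct sum of objects with local endomorphism ring. An abelian category with enough projectives and injectives is Frobenius if $\mathcal{P}(\mathcal{C})=\mathcal{I}(\mathcal{C})$. Igusa-Todorov $\Phi$-function (for $\mathcal{C}$ with the exact structure of all short exact sequences): the stable category $\underline{\mathcal{C}}$ has the objects of $\mathcal{C}$ and morphisms those of $\mathcal{C}$ modulo morphisms factoring through a projective object. The syzygy $\Omega(M)$, i.e. the kernel of an epimorphism $P\to M$ with $P$ projective, defines an additive endofunctor $\Omega$ of $\underline{\mathcal{C}}$. Let $K(\mathcal{C})$ be the free abelian group on isoclasses $[M]$ of objects of $\mathcal{C}$ modulo the relations $[N]-[S]-[T]$ when $N\cong S\oplus T$, and $[P]$ for $P$ projective; $\Omega$ induces the endomorphism $[M]\mapsto[\Omega(M)]$ of $K(\mathcal{C})$. Let $\langle M\rangle$ be the subgroup of $K(\mathcal{C})$ generated by the classes of the indecomposable direct summands of $M$ in $\underline{\mathcal{C}}$. Then $\Phi_{\mathcal{P}(\mathcal{C})}(M)=\min\{k\in\mathbb{N}:\ \Omega$ restricts to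 an isomorphism $\Omega^m(\langle M\rangle)\to\Omega^{m+1}(\langle M\rangle)$ for all $m\ge k\}$ (this exists), and $\Phi_{\mathcal{P}(\mathcal{C})}\mathrm{dim}(\mathcal{C})=\sup\{\Phi_{\mathcal{P}(\mathcal{C})}(M): M\in\mathcal{C}\}$. Dually, $\Phi^{\mathcal{I}(\mathcal{C})}$ is the corresponding function computed in the opposite category $\mathcal{C}^{op}$ (using cosyzygies and injectives), and $\Phi^{\mathcal{I}(\mathcal{C})}\mathrm{dim}(\mathcal{C})$ is its supremum over all objects of $\mathcal{C}$. *)

theory Defs
  imports "HOL-Algebra.Free_Abelian_Groups" "HOL-Algebra.Ring" "HOL-Library.Extended_Nat"
begin

section \<open>Abelian categories\<close>

text \<open>
  The objects and the morphisms of a category form sets in HOL types, so every category considered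
  here is small, and skeletal smallness is built into the typing: a skeletally small category
  is equivalent to a small one. As every morphism determines its source and its target, a sum
  of parallel morphisms needs no object arguments.
\<close>

record ('o, 'm) preadd_cat =
  obj :: "'o set"
  arr :: "'m set"
  src :: "'m \<Rightarrow> 'o"
  tgt :: "'m \<Rightarrow> 'o"
  ident :: "'o \<Rightarrow> 'm"
  cmp :: "'m \<Rightarrow> 'm \<Rightarrow> 'm"  (infixr \<open>\<cdot>\<index>\<close> 70)
  madd :: "'m \<Rightarrow> 'm \<Rightarrow> 'm"
  mzero :: "'o \<Rightarrow> 'o \<Rightarrow> 'm"

definition hom_set :: "('o, 'm) preadd_cat \<Rightarrow> 'o \<Rightarrow> 'o \<Rightarrow> 'm set" where
  "hom_set C X Y = {f \<in> arr C. src C f = X \<and> tgt C f = Y}"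

definition hom_group :: "('o, 'm) preadd_cat \<Rightarrow> 'o \<Rightarrow> 'o \<Rightarrow> 'm monoid" where
  "hom_group C X Y = \<lparr>carrier = hom_set C X Y, monoid.mult = madd C, one = mzero C X Y\<rparr>"

definition opposite :: "('o, 'm) preadd_cat \<Rightarrow> ('o, 'm) preadd_cat" where
  "opposite C = \<lparr>obj = obj C, arr = arr C, src = tgt C, tgt = src C, ident = ident C,
     cmp = (\<lambda>g f. f \<cdot>\<^bsub>C\<^esub> g), madd = madd C, mzero = (\<lambda>X Y. mzero C Y X)\<rparr>"

definition monic :: "('o, 'm) preadd_cat \<Rightarrow> 'm \<Rightarrow> bool" where
  "monic C f \<longleftrightarrow> f \<in> arr C \<and>
     (\<forall>X\<in>obj C. \<forall>g\<in>hom_set C X (src C f). \<forall>h\<in>hom_set C X (src C f).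
        f \<cdot>\<^bsub>C\<^esub> g = f \<cdot>\<^bsub>C\<^esub> h \<longrightarrow> g = h)"

definition epic :: "('o, 'm) preadd_cat \<Rightarrow> 'm \<Rightarrow> bool" where
  "epic C f \<longleftrightarrow> f \<in> arr C \<and>
     (\<forall>X\<in>obj C. \<forall>g\<in>hom_set C (tgt C f) X. \<forall>h\<in>hom_set C (tgt C f) X.
        g \<cdot>\<^bsub>C\<^esub> f = h \<cdot>\<^bsub>C\<^esub> f \<longrightarrow> g = h)"

definition isomorphic_obj :: "('o, 'm) preadd_cat \<Rightarrow> 'o \<Rightarrow> 'o \<Rightarrow> bool" where
  "isomorphic_obj C X Y \<longleftrightarrow>
     (\<exists>f\<in>hom_set C X Y. \<exists>g\<in>hom_set C Y X. g \<cdot>\<^bsub>C\<^esub> f = ident C X \<and> f \<cdot>\<^bsub>C\<^esub> g = ident C Y)"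

definition zero_obj :: "('o, 'm) preadd_cat \<Rightarrow> 'o \<Rightarrow> bool" where
  "zero_obj C Z \<longleftrightarrow> Z \<in> obj C \<and>
     (\<forall>X\<in>obj C. (\<exists>!f. f \<in> hom_set C Z X) \<and> (\<exists>!f. f \<in> hom_set C X Z))"

definition is_kernel :: "('o, 'm) preadd_cat \<Rightarrow> 'm \<Rightarrow> 'm \<Rightarrow> bool" where
  "is_kernel C k f \<longleftrightarrow> f \<in> arr C \<and> k \<in> arr C \<and> tgt C k = src C f \<and>
     f \<cdot>\<^bsub>C\<^esub> k = mzero C (src C k) (tgt C f) \<and>
     (\<forall>X\<in>obj C. \<forall>g\<in>hom_set C X (src C f). f \<cdot>\<^bsub>C\<^esub> g = mzero C X (tgt C f) \<longrightarrow>
        (\<exists>!u. u \<in> hom_set C X (src C k) \<and> k \<cdot>\<^bsub>C\<^esub> u = g))"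

definition is_cokernel :: "('o, 'm) preadd_cat \<Rightarrow> 'm \<Rightarrow> 'm \<Rightarrow> bool" where
  "is_cokernel C q f \<longleftrightarrow> f \<in> arr C \<and> q \<in> arr C \<and> src C q = tgt C f \<and>
     q \<cdot>\<^bsub>C\<^esub> f = mzero C (src C f) (tgt C q) \<and>
     (\<forall>X\<in>obj C. \<forall>g\<in>hom_set C (tgt C f) X. g \<cdot>\<^bsub>C\<^esub> f = mzero C (src C f) X \<longrightarrow>
        (\<exists>!u. u \<in> hom_set C (tgt C q) X \<and> u \<cdot>\<^bsub>C\<^esub> q = g))"

text \<open>
  \<open>direct_sum C X Ys\<close>: the object \<open>X\<close> carries the structure of a biproduct of the finite family
  \<open>Ys\<close> (equivalently, it is isomorphic to any chosen direct sum of \<open>Ys\<close>). The product in the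
  last clause is a sum in the additively written group of endomorphisms of \<open>X\<close>.
\<close>

definition direct_sum :: "('o, 'm) preadd_cat \<Rightarrow> 'o \<Rightarrow> 'o list \<Rightarrow> bool" where
  "direct_sum C X Ys \<longleftrightarrow> X \<in> obj C \<and> set Ys \<subseteq> obj C \<and>
     (\<exists>\<iota> \<pi>. (\<forall>k<length Ys. \<iota> k \<in> hom_set C (Ys ! k) X \<and> \<pi> k \<in> hom_set C X (Ys ! k)) \<and>
        (\<forall>j<length Ys. \<forall>k<length Ys.
           \<pi> j \<cdot>\<^bsub>C\<^esub> \<iota> k = (if j = k then ident C (Ys ! k) else mzero C (Ys ! k) (Ys ! j))) \<and>
        finprod (hom_group C X X) (\<lambda>k. \<iota> k \<cdot>\<^bsub>C\<^esub> \<pi> k) {..<length Ys} = ident C X)"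

locale preadditive_category =
  fixes C :: "('o, 'm) preadd_cat" (structure)
  assumes src_obj: "f \<in> arr C \<Longrightarrow> src C f \<in> obj C"
    and tgt_obj: "f \<in> arr C \<Longrightarrow> tgt C f \<in> obj C"
    and ident_hom: "X \<in> obj C \<Longrightarrow> ident C X \<in> hom_set C X X"
    and cmp_hom: "\<lbrakk>f \<in> hom_set C X Y; g \<in> hom_set C Y Z\<rbrakk> \<Longrightarrow> g \<cdot> f \<in> hom_set C X Z"
    and cmp_assoc: "\<lbrakk>f \<in> hom_set C W X; g \<in> hom_set C X Y; h \<in> hom_set C Y Z\<rbrakk>
                      \<Longrightarrow> (h \<cdot> g) \<cdot> f = h \<cdot> (g \<cdot> f)"
    and ident_left: "f \<in> hom_set C X Y \<Longrightarrow> ident C Y \<cdot> f = f"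
    and ident_right: "f \<in> hom_set C X Y \<Longrightarrow> f \<cdot> ident C X = f"
    and hom_comm_group: "\<lbrakk>X \<in> obj C; Y \<in> obj C\<rbrakk> \<Longrightarrow> comm_group (hom_group C X Y)"
    and cmp_madd_left: "\<lbrakk>f \<in> hom_set C X Y; g \<in> hom_set C Y Z; h \<in> hom_set C Y Z\<rbrakk>
                          \<Longrightarrow> madd C g h \<cdot> f = madd C (g \<cdot> f) (h \<cdot> f)"
    and cmp_madd_right: "\<lbrakk>f \<in> hom_set C X Y; g \<in> hom_set C X Y; h \<in> hom_set C Y Z\<rbrakk>
                          \<Longrightarrow> h \<cdot> madd C f g = madd C (h \<cdot> f) (h \<cdot> g)"

locale additive_category = preadditive_category +
  assumes ex_zero_obj: "\<exists>Z. zero_obj C Z"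
    and ex_direct_sum: "\<lbrakk>X \<in> obj C; Y \<in> obj C\<rbrakk> \<Longrightarrow> \<exists>S. direct_sum C S [X, Y]"

locale abelian_category = additive_category +
  assumes ex_kernel: "f \<in> arr C \<Longrightarrow> \<exists>k. is_kernel C k f"
    and ex_cokernel: "f \<in> arr C \<Longrightarrow> \<exists>q. is_cokernel C q f"
    and monic_normal: "monic C f \<Longrightarrow> \<exists>g. is_kernel C f g"
    and epic_normal: "epic C f \<Longrightarrow> \<exists>g. is_cokernel C f g"


section \<open>Krull-Schmidt and Frobenius categories\<close>

definition End_ring :: "('o, 'm) preadd_cat \<Rightarrow> 'o \<Rightarrow> 'm ring" where
  "End_ring C X = \<lparr>carrier = hom_set C X X, monoid.mult = cmp C, one = ident C X,
     zero = mzero C X X, add = madd C\<rparr>"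

text \<open>Local rings, not necessarily commutative: nonzero, and the non-units are closed under addition.\<close>

definition local_ring :: "('a, 'b) ring_scheme \<Rightarrow> bool" where
  "local_ring R \<longleftrightarrow> ring R \<and> \<one>\<^bsub>R\<^esub> \<noteq> \<zero>\<^bsub>R\<^esub> \<and>
     (\<forall>x\<in>carrier R - Units R. \<forall>y\<in>carrier R - Units R. x \<oplus>\<^bsub>R\<^esub> y \<notin> Units R)"

definition krull_schmidt :: "('o, 'm) preadd_cat \<Rightarrow> bool" where
  "krull_schmidt C \<longleftrightarrow>
     (\<forall>X\<in>obj C. \<exists>Ys. direct_sum C X Ys \<and> (\<forall>Y\<in>set Ys. local_ring (End_ring C Y)))"

definition projectives :: "('o, 'm) preadd_cat \<Rightarrow> 'o set" where
  "projectives C = {P \<in> obj C. \<forall>e f. epic C e \<and> f \<in> hom_set C P (tgt C e) \<longrightarrow>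
     (\<exists>g\<in>hom_set C P (src C e). e \<cdot>\<^bsub>C\<^esub> g = f)}"

definition injectives :: "('o, 'm) preadd_cat \<Rightarrow> 'o set" where
  "injectives C = {I \<in> obj C. \<forall>m f. monic C m \<and> f \<in> hom_set C (src C m) I \<longrightarrow>
     (\<exists>g\<in>hom_set C (tgt C m) I. g \<cdot>\<^bsub>C\<^esub> m = f)}"

definition enough_projectives :: "('o, 'm) preadd_cat \<Rightarrow> bool" where
  "enough_projectives C \<longleftrightarrow> (\<forall>X\<in>obj C. \<exists>P\<in>projectives C. \<exists>p\<in>hom_set C P X. epic C p)"

definition enough_injectives :: "('o, 'm) preadd_cat \<Rightarrow> bool" where
  "enough_injectives C \<longleftrightarrow> (\<forall>X\<in>obj C. \<exists>I\<in>injectives C. \<exists>i\<in>hom_set C X I. monic C i)"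

definition frobenius_category :: "('o, 'm) preadd_cat \<Rightarrow> bool" where
  "frobenius_category C \<longleftrightarrow> abelian_category C \<and> enough_projectives C \<and> enough_injectives C \<and>
     projectives C = injectives C"


section \<open>The stable category\<close>

definition proj_homs :: "('o, 'm) preadd_cat \<Rightarrow> 'o \<Rightarrow> 'o \<Rightarrow> 'm set" where
  "proj_homs C X Y = {h \<cdot>\<^bsub>C\<^esub> g |g h P. P \<in> projectives C \<and> g \<in> hom_set C X P \<and> h \<in> hom_set C P Y}"

definition stable_class :: "('o, 'm) preadd_cat \<Rightarrow> 'm \<Rightarrow> 'm set" where
  "stable_class C f =
     proj_homs C (src C f) (tgt C f) #>\<^bsub>hom_group C (src C f) (tgt C f)\<^esub> f"

text \<open>
  The hom-sets are the groups \<open>hom_group C X Y Mod proj_homs C X Y\<close>. The union defining the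
  composite of two cosets is a union of equal cosets.
\<close>

definition stable :: "('o, 'm) preadd_cat \<Rightarrow> ('o, 'm set) preadd_cat" where
  "stable C = \<lparr>obj = obj C,
     arr = stable_class C ` arr C,
     src = (\<lambda>F. src C (SOME f. f \<in> F)),
     tgt = (\<lambda>F. tgt C (SOME f. f \<in> F)),
     ident = (\<lambda>X. stable_class C (ident C X)),
     cmp = (\<lambda>G F. \<Union>g\<in>G. \<Union>f\<in>F. stable_class C (g \<cdot>\<^bsub>C\<^esub> f)),
     madd = (\<lambda>F G. {madd C f g |f g. f \<in> F \<and> g \<in> G}),
     mzero = (\<lambda>X Y. stable_class C (mzero C X Y))\<rparr>"

definition indecomposable :: "('o, 'm) preadd_cat \<Rightarrow> 'o \<Rightarrow> bool" where
  "indecomposable C X \<longleftrightarrow> X \<in> obj C \<and> \<not> zero_obj C X \<and>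
     (\<forall>Y Z. direct_sum C X [Y, Z] \<longrightarrow> zero_obj C Y \<or> zero_obj C Z)"

definition direct_summand :: "('o, 'm) preadd_cat \<Rightarrow> 'o \<Rightarrow> 'o \<Rightarrow> bool" where
  "direct_summand C X M \<longleftrightarrow> (\<exists>Y. direct_sum C M [X, Y])"


section \<open>The Igusa-Todorov function\<close>

definition iso_class :: "('o, 'm) preadd_cat \<Rightarrow> 'o \<Rightarrow> 'o set" where
  "iso_class C M = {N \<in> obj C. isomorphic_obj C M N}"

definition K_free :: "('o, 'm) preadd_cat \<Rightarrow> ('o set \<Rightarrow>\<^sub>0 int) monoid" where
  "K_free C = free_Abelian_group (iso_class C ` obj C)"

definition K_relations :: "('o, 'm) preadd_cat \<Rightarrow> ('o set \<Rightarrow>\<^sub>0 int) set" where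
  "K_relations C = generate (K_free C)
     ({frag_of (iso_class C N) - frag_of (iso_class C S) - frag_of (iso_class C T) |N S T.
         direct_sum C N [S, T]} \<union>
      {frag_of (iso_class C P) |P. P \<in> projectives C})"

definition K_group :: "('o, 'm) preadd_cat \<Rightarrow> ('o set \<Rightarrow>\<^sub>0 int) set monoid" where
  "K_group C = K_free C Mod K_relations C"

definition K_class :: "('o, 'm) preadd_cat \<Rightarrow> 'o \<Rightarrow> ('o set \<Rightarrow>\<^sub>0 int) set" where
  "K_class C M = K_relations C #>\<^bsub>K_free C\<^esub> frag_of (iso_class C M)"

definition is_syzygy :: "('o, 'm) preadd_cat \<Rightarrow> 'o \<Rightarrow> 'o \<Rightarrow> bool" where
  "is_syzygy C M N \<longleftrightarrow>
     (\<exists>P\<in>projectives C. \<exists>p\<in>hom_set C P M. \<exists>i\<in>hom_set C N P. epic C p \<and> is_kernel C i p)"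

text \<open>
  In an abelian category with enough projectives the following endomorphism exists by Schanuel's
  lemma. It is unique because the classes of objects generate \<open>K_group C\<close>; extensionality fixes its
  value outside the carrier.
\<close>

definition Omega :: "('o, 'm) preadd_cat \<Rightarrow> ('o set \<Rightarrow>\<^sub>0 int) set \<Rightarrow> ('o set \<Rightarrow>\<^sub>0 int) set" where
  "Omega C = (THE \<omega>. \<omega> \<in> hom (K_group C) (K_group C) \<inter> extensional (carrier (K_group C)) \<and>
     (\<forall>M N. is_syzygy C M N \<longrightarrow> \<omega> (K_class C M) = K_class C N))"

definition K_span :: "('o, 'm) preadd_cat \<Rightarrow> 'o \<Rightarrow> ('o set \<Rightarrow>\<^sub>0 int) set set" where
  "K_span C M = generate (K_group C)
     {K_class C X |X. indecomposable (stable C) X \<and> direct_summand (stable C) X M}"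

definition Omega_image :: "('o, 'm) preadd_cat \<Rightarrow> nat \<Rightarrow> 'o \<Rightarrow> ('o set \<Rightarrow>\<^sub>0 int) set monoid" where
  "Omega_image C m M = (K_group C)\<lparr>carrier := (Omega C ^^ m) ` K_span C M\<rparr>"

text \<open>
  The infimum in \<open>enat\<close> of a nonempty set of natural numbers is its minimum; it is \<open>\<infinity>\<close> only for
  the empty set.
\<close>

definition phi :: "('o, 'm) preadd_cat \<Rightarrow> 'o \<Rightarrow> enat" where
  "phi C M =
     Inf (enat ` {k. \<forall>m\<ge>k. Omega C \<in> iso (Omega_image C m M) (Omega_image C (Suc m) M)})"

definition phi_dim :: "('o, 'm) preadd_cat \<Rightarrow> enat" where
  "phi_dim C = (SUP M\<in>obj C. phi C M)"

definition cophi_dim :: "('o, 'm) preadd_cat \<Rightarrow> enat" where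
  "cophi_dim C = phi_dim (opposite C)"

end

theory Submission
  imports Defs
begin

text \<open>
  If projective and injective objects agree, a short exact sequence \<open>0 \<rightarrow> N \<rightarrow> P \<rightarrow> M \<rightarrow> 0\<close> with \<open>P\<close>
  projective shows both that \<open>N\<close> is a syzygy of \<open>M\<close> and that \<open>M\<close> is a cosyzygy of \<open>N\<close>. The
  endomorphisms \<open>\<Omega>\<close> of \<open>C\<close> and of its opposite then act on one and the same group of stable
  classes and are inverse to each other, so \<open>\<Omega>\<close> is injective and both dimensions vanish
  (\<open>frobenius_phi_dim\<close>).

  Conversely, suppose that both dimensions vanish. Then \<open>\<Omega>\<close> and its dual are injective on the
  subgroup spanned by the stably indecomposable summands of any object. Let \<open>P\<close> be projective, and
  choose an exact sequence \<open>0 \<rightarrow> P \<rightarrow> I \<rightarrow> Q \<rightarrow> 0\<close> with \<open>I\<close> injective. Pulling \<open>I \<rightarrow> Q\<close> back along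
  an epimorphism from a projective object onto \<open>Q\<close> shows that \<open>I\<close> and \<open>Q\<close> have a common syzygy
  (\<open>syzygy_of_projective_extension\<close>), so they have the same class. Krull-Schmidt multiplicities of
  nonprojective local objects depend on classes only (\<open>ks_mult_eq_of_K_class_eq\<close>), so every
  nonprojective local summand of \<open>Q\<close> is a summand of \<open>I\<close>, and a projective summand of \<open>Q\<close> lifts to
  one of \<open>I\<close>. Thus \<open>Q\<close> is injective. In the opposite category, \<open>Q\<close> is now a projective object and
  a syzygy of \<open>P\<close>, hence a common syzygy of \<open>P\<close> and the zero object. So the class of \<open>P\<close> is trivial
  there, which makes \<open>P\<close> injective (\<open>projectives_subset_injectives\<close>). The other inclusion is dual.

  Three facts support this. The syzygy endomorphism is well defined by Schanuel's lemma
  (\<open>schanuel\<close>). Krull-Schmidt multiplicities are well defined by the exchange property of local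
  summands (\<open>ks_mult_cancel\<close>), which rests on an elimination step (\<open>complements_isomorphic\<close>). The
  subgroup attached to \<open>M\<close> is generated by classes of indecomposable objects of the stable category,
  whereas decompositions are given in \<open>C\<close>; a nonprojective local object stays local in the stable
  category (\<open>stable_local_obj\<close>), and therefore this subgroup contains the classes of all summands of
  \<open>M\<close> (\<open>K_class_in_K_span\<close>).
\<close>


section \<open>Arithmetic of morphisms in a preadditive category\<close>

lemma hom_group_simps [simp]:
  "carrier (hom_group C X Y) = hom_set C X Y"
  "monoid.mult (hom_group C X Y) = madd C"
  "one (hom_group C X Y) = mzero C X Y"
  by (simp_all add: hom_group_def)

definition mneg :: "('o, 'm) preadd_cat \<Rightarrow> 'm \<Rightarrow> 'm" where
  "mneg C f = inv\<^bsub>hom_group C (src C f) (tgt C f)\<^esub> f"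

definition iso_arr :: "('o, 'm) preadd_cat \<Rightarrow> 'm \<Rightarrow> bool" where
  "iso_arr C f \<longleftrightarrow> f \<in> arr C \<and>
     (\<exists>g\<in>hom_set C (tgt C f) (src C f).
        g \<cdot>\<^bsub>C\<^esub> f = ident C (src C f) \<and> f \<cdot>\<^bsub>C\<^esub> g = ident C (tgt C f))"

definition retract :: "('o, 'm) preadd_cat \<Rightarrow> 'o \<Rightarrow> 'o \<Rightarrow> bool" where
  "retract C X M \<longleftrightarrow> (\<exists>s\<in>hom_set C X M. \<exists>r\<in>hom_set C M X. r \<cdot>\<^bsub>C\<^esub> s = ident C X)"

definition biprod :: "('o, 'm) preadd_cat \<Rightarrow> 'o \<Rightarrow> 'o \<Rightarrow> 'o \<Rightarrow> 'm \<Rightarrow> 'm \<Rightarrow> 'm \<Rightarrow> 'm \<Rightarrow> bool" where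
  "biprod C X A B i j p q \<longleftrightarrow> i \<in> hom_set C A X \<and> j \<in> hom_set C B X \<and>
     p \<in> hom_set C X A \<and> q \<in> hom_set C X B \<and>
     p \<cdot>\<^bsub>C\<^esub> i = ident C A \<and> q \<cdot>\<^bsub>C\<^esub> j = ident C B \<and> p \<cdot>\<^bsub>C\<^esub> j = mzero C B A \<and> q \<cdot>\<^bsub>C\<^esub> i = mzero C A B \<and>
     madd C (i \<cdot>\<^bsub>C\<^esub> p) (j \<cdot>\<^bsub>C\<^esub> q) = ident C X"

text \<open>
  Typing side conditions are stated through source and target rather than through hom-sets: no
  rule then has a variable that occurs in its premises only, so that the simplifier can discharge
  them.
\<close>

context preadditive_category
begin

abbreviation Hom where "Hom \<equiv> hom_set C"
abbreviation plus (infixl \<open>\<boxplus>\<close> 65) where "f \<boxplus> g \<equiv> madd C f g"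
abbreviation Id where "Id \<equiv> ident C"
abbreviation Zero where "Zero \<equiv> mzero C"
abbreviation Neg where "Neg \<equiv> mneg C"

lemma Hom_iff: "f \<in> Hom X Y \<longleftrightarrow> f \<in> arr C \<and> src C f = X \<and> tgt C f = Y"
  by (simp add: hom_set_def)

lemma Hom_obj: "f \<in> Hom X Y \<Longrightarrow> X \<in> obj C \<and> Y \<in> obj C"
  using src_obj tgt_obj by (auto simp: Hom_iff)

lemma arr_Hom: "f \<in> arr C \<Longrightarrow> f \<in> Hom (src C f) (tgt C f)"
  by (simp add: Hom_iff)

lemma ident_simps [simp]:
  assumes "X \<in> obj C"
  shows "Id X \<in> arr C" "src C (Id X) = X" "tgt C (Id X) = X"
  using ident_hom[OF assms] by (simp_all add: Hom_iff)

lemma cmp_simps [simp]: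
  assumes "f \<in> arr C" "g \<in> arr C" "tgt C f = src C g"
  shows "g \<cdot> f \<in> arr C" "src C (g \<cdot> f) = src C f" "tgt C (g \<cdot> f) = tgt C g"
  using cmp_hom[of f "src C f" "tgt C f" g "tgt C g"] assms by (simp_all add: Hom_iff)

lemma zero_simps [simp]:
  assumes "X \<in> obj C" "Y \<in> obj C"
  shows "Zero X Y \<in> arr C" "src C (Zero X Y) = X" "tgt C (Zero X Y) = Y"
proof -
  interpret comm_group "hom_group C X Y" by (rule hom_comm_group[OF assms])
  show "Zero X Y \<in> arr C" "src C (Zero X Y) = X" "tgt C (Zero X Y) = Y"
    using one_closed by (simp_all add: Hom_iff)
qed

lemma add_simps [simp]:
  assumes "f \<in> arr C" "g \<in> arr C" "src C f = src C g" "tgt C f = tgt C g"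
  shows "f \<boxplus> g \<in> arr C" "src C (f \<boxplus> g) = src C g" "tgt C (f \<boxplus> g) = tgt C g"
proof -
  interpret comm_group "hom_group C (src C g) (tgt C g)"
    using assms src_obj tgt_obj by (intro hom_comm_group) auto
  have "f \<boxplus> g \<in> Hom (src C g) (tgt C g)"
    using m_closed[of f g] assms by (simp add: Hom_iff)
  then show "f \<boxplus> g \<in> arr C" "src C (f \<boxplus> g) = src C g" "tgt C (f \<boxplus> g) = tgt C g"
    by (simp_all add: Hom_iff)
qed

lemma neg_simps [simp]:
  assumes "f \<in> arr C"
  shows "Neg f \<in> arr C" "src C (Neg f) = src C f" "tgt C (Neg f) = tgt C f"
    "f \<boxplus> Neg f = Zero (src C f) (tgt C f)" "Neg f \<boxplus> f = Zero (src C f) (tgt C f)"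
proof -
  interpret comm_group "hom_group C (src C f) (tgt C f)"
    using assms src_obj tgt_obj by (intro hom_comm_group) auto
  have c: "f \<in> carrier (hom_group C (src C f) (tgt C f))"
    using assms by (simp add: Hom_iff)
  show "Neg f \<in> arr C" "src C (Neg f) = src C f" "tgt C (Neg f) = tgt C f"
    using inv_closed[OF c] by (simp_all add: mneg_def Hom_iff)
  show "f \<boxplus> Neg f = Zero (src C f) (tgt C f)" "Neg f \<boxplus> f = Zero (src C f) (tgt C f)"
    using r_inv[OF c] l_inv[OF c] by (simp_all add: mneg_def)
qed

lemma src_tgt_obj [simp]: "f \<in> arr C \<Longrightarrow> src C f \<in> obj C" "f \<in> arr C \<Longrightarrow> tgt C f \<in> obj C"
  by (auto simp: src_obj tgt_obj)

lemma assoc: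
  assumes "f \<in> arr C" "g \<in> arr C" "h \<in> arr C" "tgt C f = src C g" "tgt C g = src C h"
  shows "(h \<cdot> g) \<cdot> f = h \<cdot> (g \<cdot> f)"
  using assms cmp_assoc[of f "src C f" "tgt C f" g "tgt C g" h "tgt C h"] by (simp add: Hom_iff)

lemma id_cmp [simp]:
  assumes "f \<in> arr C"
  shows "tgt C f = Y \<Longrightarrow> Id Y \<cdot> f = f" "src C f = X \<Longrightarrow> f \<cdot> Id X = f"
  using assms ident_left[OF arr_Hom] ident_right[OF arr_Hom] by auto

lemma distrib:
  assumes "f \<in> arr C" "g \<in> arr C" "h \<in> arr C"
  shows "\<lbrakk>src C g = src C h; tgt C g = tgt C h; tgt C f = src C h\<rbrakk>
      \<Longrightarrow> (g \<boxplus> h) \<cdot> f = g \<cdot> f \<boxplus> h \<cdot> f"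
    and "\<lbrakk>src C f = src C g; tgt C f = tgt C g; tgt C g = src C h\<rbrakk>
      \<Longrightarrow> h \<cdot> (f \<boxplus> g) = h \<cdot> f \<boxplus> h \<cdot> g"
  using assms cmp_madd_left[of f "src C f" "tgt C f" g "tgt C g" h]
    cmp_madd_right[of f "src C f" "tgt C f" g h "tgt C h"]
  by (simp_all add: Hom_iff)

lemma add_assoc:
  assumes "f \<in> arr C" "g \<in> arr C" "h \<in> arr C" "src C f = src C h" "tgt C f = tgt C h"
    "src C g = src C h" "tgt C g = tgt C h"
  shows "(f \<boxplus> g) \<boxplus> h = f \<boxplus> (g \<boxplus> h)"
proof -
  interpret comm_group "hom_group C (src C h) (tgt C h)"
    using assms by (intro hom_comm_group) auto
  show ?thesis using m_assoc[of f g h] assms by (simp add: Hom_iff)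
qed

lemma add_commute:
  assumes "f \<in> arr C" "g \<in> arr C" "src C f = src C g" "tgt C f = tgt C g"
  shows "f \<boxplus> g = g \<boxplus> f"
proof -
  interpret comm_group "hom_group C (src C g) (tgt C g)"
    using assms by (intro hom_comm_group) auto
  show ?thesis using m_comm[of f g, unfolded hom_group_simps Hom_iff] assms by blast
qed

lemma add_left_commute:
  assumes "f \<in> arr C" "g \<in> arr C" "h \<in> arr C" "src C f = src C h" "tgt C f = tgt C h"
    "src C g = src C h" "tgt C g = tgt C h"
  shows "f \<boxplus> (g \<boxplus> h) = g \<boxplus> (f \<boxplus> h)"
proof -
  interpret comm_group "hom_group C (src C h) (tgt C h)"
    using assms by (intro hom_comm_group) auto
  show ?thesis using m_lcomm[of f g h, unfolded hom_group_simps Hom_iff] assms by blast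
qed

lemmas add_ac = add_assoc add_commute add_left_commute

lemma add_zero [simp]:
  assumes "f \<in> arr C"
  shows "\<lbrakk>src C f = X; tgt C f = Y\<rbrakk> \<Longrightarrow> f \<boxplus> Zero X Y = f"
    "\<lbrakk>src C f = X; tgt C f = Y\<rbrakk> \<Longrightarrow> Zero X Y \<boxplus> f = f"
proof -
  interpret comm_group "hom_group C (src C f) (tgt C f)"
    using assms by (intro hom_comm_group) auto
  show "\<lbrakk>src C f = X; tgt C f = Y\<rbrakk> \<Longrightarrow> f \<boxplus> Zero X Y = f"
    "\<lbrakk>src C f = X; tgt C f = Y\<rbrakk> \<Longrightarrow> Zero X Y \<boxplus> f = f"
    using r_one[of f] l_one[of f] assms by (auto simp: Hom_iff)
qed

lemma add_cancel:
  assumes "f \<in> arr C" "g \<in> arr C" "h \<in> arr C" "src C f = src C h" "tgt C f = tgt C h"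
    "src C g = src C h" "tgt C g = tgt C h"
  shows "f \<boxplus> g = f \<boxplus> h \<longleftrightarrow> g = h"
proof -
  interpret comm_group "hom_group C (src C h) (tgt C h)"
    using assms by (intro hom_comm_group) auto
  show ?thesis using Units_l_cancel[of f g h, unfolded Units_eq hom_group_simps Hom_iff] assms by blast
qed

lemma neg_unique:
  assumes "f \<in> arr C" "g \<in> arr C" "src C f = src C g" "tgt C f = tgt C g"
    "f \<boxplus> g = Zero (src C g) (tgt C g)"
  shows "g = Neg f"
proof -
  have "f \<boxplus> g = f \<boxplus> Neg f" using assms by simp
  then show ?thesis using assms by (subst (asm) add_cancel) simp_all
qed

lemma zero_cmp [simp]:
  assumes "f \<in> arr C" "Z \<in> obj C"
  shows "tgt C f = Y \<Longrightarrow> Zero Y Z \<cdot> f = Zero (src C f) Z"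
    and "src C f = Y \<Longrightarrow> f \<cdot> Zero Z Y = Zero Z (tgt C f)"
proof -
  assume Y: "tgt C f = Y"
  then have [simp]: "Y \<in> obj C" using assms by auto
  have "Zero Y Z \<cdot> f \<boxplus> Zero Y Z \<cdot> f = Zero Y Z \<cdot> f \<boxplus> Zero (src C f) Z"
    using distrib(1)[of f "Zero Y Z" "Zero Y Z"] assms Y by simp
  then show "Zero Y Z \<cdot> f = Zero (src C f) Z"
    using assms Y by (subst (asm) add_cancel) auto
next
  assume Y: "src C f = Y"
  then have [simp]: "Y \<in> obj C" using assms by auto
  have "f \<cdot> Zero Z Y \<boxplus> f \<cdot> Zero Z Y = f \<cdot> Zero Z Y \<boxplus> Zero Z (tgt C f)"
    using distrib(2)[of "Zero Z Y" "Zero Z Y" f] assms Y by simp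
  then show "f \<cdot> Zero Z Y = Zero Z (tgt C f)"
    using assms Y by (subst (asm) add_cancel) auto
qed

lemma neg_cmp:
  assumes "f \<in> arr C" "g \<in> arr C" "tgt C f = src C g"
  shows "Neg g \<cdot> f = Neg (g \<cdot> f)" "g \<cdot> Neg f = Neg (g \<cdot> f)"
proof -
  have "g \<cdot> f \<boxplus> Neg g \<cdot> f = Zero (src C f) (tgt C g)"
    using distrib(1)[of f g "Neg g"] assms by simp
  then show "Neg g \<cdot> f = Neg (g \<cdot> f)" using assms by (intro neg_unique) auto
  have "g \<cdot> f \<boxplus> g \<cdot> Neg f = Zero (src C f) (tgt C g)"
    using distrib(2)[of f "Neg f" g] assms by simp
  then show "g \<cdot> Neg f = Neg (g \<cdot> f)" using assms by (intro neg_unique) auto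
qed

lemma neg_zero [simp]: "X \<in> obj C \<Longrightarrow> Y \<in> obj C \<Longrightarrow> Neg (Zero X Y) = Zero X Y"
  using neg_unique[of "Zero X Y" "Zero X Y"] by simp

lemma eq_if_diff_zero:
  assumes "f \<in> arr C" "g \<in> arr C" "src C f = src C g" "tgt C f = tgt C g"
    "f \<boxplus> Neg g = Zero (src C g) (tgt C g)"
  shows "f = g"
  using add_cancel[of "Neg g" f g] add_commute[of f "Neg g"] assms by simp

text \<open>The rule lets an equation between composites act inside a right-nested composite.\<close>

lemma cmp_reduce:
  assumes "a \<cdot> b = c" "a \<in> arr C" "b \<in> arr C" "x \<in> arr C" "tgt C b = src C a" "tgt C x = src C b"
  shows "a \<cdot> (b \<cdot> x) = c \<cdot> x"
  using assms assoc[of x b a] by simp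

lemma epicI:
  assumes "f \<in> Hom X Y" "\<And>T t. t \<in> Hom Y T \<Longrightarrow> t \<cdot> f = Zero X T \<Longrightarrow> t = Zero Y T"
  shows "epic C f"
  unfolding epic_def
proof (intro conjI ballI impI)
  show "f \<in> arr C" using assms by (simp add: Hom_iff)
  fix T g h assume T: "T \<in> obj C" "g \<in> Hom (tgt C f) T" "h \<in> Hom (tgt C f) T" "g \<cdot> f = h \<cdot> f"
  note [simp] = assms(1)[unfolded Hom_iff] T(2,3)[unfolded Hom_iff] T(1)
  have "(g \<boxplus> Neg h) \<cdot> f = Zero X T"
    using T(4) by (simp add: distrib neg_cmp)
  then have e: "g \<boxplus> Neg h = Zero Y T"
    by (intro assms(2)) (simp_all add: Hom_iff)
  show "g = h" by (rule eq_if_diff_zero) (simp_all add: e)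
qed

lemma monicI:
  assumes "f \<in> Hom X Y" "\<And>T t. t \<in> Hom T X \<Longrightarrow> f \<cdot> t = Zero T Y \<Longrightarrow> t = Zero T X"
  shows "monic C f"
  unfolding monic_def
proof (intro conjI ballI impI)
  show "f \<in> arr C" using assms by (simp add: Hom_iff)
  fix T g h assume T: "T \<in> obj C" "g \<in> Hom T (src C f)" "h \<in> Hom T (src C f)" "f \<cdot> g = f \<cdot> h"
  note [simp] = assms(1)[unfolded Hom_iff] T(2,3)[unfolded Hom_iff] T(1)
  have "f \<cdot> (g \<boxplus> Neg h) = Zero T Y"
    using T(4) by (simp add: distrib neg_cmp)
  then have e: "g \<boxplus> Neg h = Zero T X"
    by (intro assms(2)) (simp_all add: Hom_iff)
  show "g = h" by (rule eq_if_diff_zero) (simp_all add: e)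
qed

lemma epicD:
  assumes "epic C f" "f \<in> Hom X Y" "g \<in> Hom Y T" "h \<in> Hom Y T" "g \<cdot> f = h \<cdot> f"
  shows "g = h"
proof -
  have "tgt C f = Y" "T \<in> obj C" using assms Hom_obj by (auto simp: Hom_iff)
  then show ?thesis using assms unfolding epic_def by blast
qed

lemma monicD:
  assumes "monic C f" "f \<in> Hom X Y" "g \<in> Hom T X" "h \<in> Hom T X" "f \<cdot> g = f \<cdot> h"
  shows "g = h"
proof -
  have "src C f = X" "T \<in> obj C" using assms Hom_obj by (auto simp: Hom_iff)
  then show ?thesis using assms unfolding monic_def by blast
qed

lemma epic_zeroD:
  assumes "epic C f" "f \<in> Hom X Y" "t \<in> Hom Y T" "t \<cdot> f = Zero X T"
  shows "t = Zero Y T"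
proof (rule epicD[OF assms(1-3)])
  show "Zero Y T \<in> Hom Y T" "t \<cdot> f = Zero Y T \<cdot> f"
    using assms(2-4) Hom_obj[OF assms(3)] by (simp_all add: Hom_iff)
qed

lemma monic_zeroD:
  assumes "monic C f" "f \<in> Hom X Y" "t \<in> Hom T X" "f \<cdot> t = Zero T Y"
  shows "t = Zero T X"
proof (rule monicD[OF assms(1-3)])
  show "Zero T X \<in> Hom T X" "f \<cdot> t = f \<cdot> Zero T X"
    using assms(2-4) Hom_obj[OF assms(3)] by (simp_all add: Hom_iff)
qed

lemma kernelD:
  assumes "is_kernel C k f" "k \<in> Hom K X" "f \<in> Hom X Y"
  shows "f \<cdot> k = Zero K Y"
    and "\<And>T g. \<lbrakk>g \<in> Hom T X; f \<cdot> g = Zero T Y\<rbrakk> \<Longrightarrow> \<exists>u\<in>Hom T K. k \<cdot> u = g"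
    and "\<And>T g. \<lbrakk>g \<in> Hom T X; f \<cdot> g = Zero T Y\<rbrakk> \<Longrightarrow> \<exists>!u. u \<in> Hom T K \<and> k \<cdot> u = g"
proof -
  have e: "src C k = K" "src C f = X" "tgt C f = Y" using assms by (simp_all add: Hom_iff)
  note a = assms(1)[unfolded is_kernel_def e]
  show "f \<cdot> k = Zero K Y" using a by blast
  show 1: "\<exists>!u. u \<in> Hom T K \<and> k \<cdot> u = g" if "g \<in> Hom T X" "f \<cdot> g = Zero T Y" for T g
    using a that Hom_obj[OF that(1)] by blast
  show "\<exists>u\<in>Hom T K. k \<cdot> u = g" if "g \<in> Hom T X" "f \<cdot> g = Zero T Y" for T g
    using 1[OF that] by blast
qed

lemma cokernelD:
  assumes "is_cokernel C q f" "f \<in> Hom X Y" "q \<in> Hom Y Q"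
  shows "q \<cdot> f = Zero X Q"
    and "\<And>T g. \<lbrakk>g \<in> Hom Y T; g \<cdot> f = Zero X T\<rbrakk> \<Longrightarrow> \<exists>!u. u \<in> Hom Q T \<and> u \<cdot> q = g"
proof -
  have e: "src C f = X" "tgt C f = Y" "tgt C q = Q" using assms by (simp_all add: Hom_iff)
  note a = assms(1)[unfolded is_cokernel_def e]
  show "q \<cdot> f = Zero X Q" using a by blast
  show "\<exists>!u. u \<in> Hom Q T \<and> u \<cdot> q = g" if "g \<in> Hom Y T" "g \<cdot> f = Zero X T" for T g
    using a that Hom_obj[OF that(1)] by blast
qed

lemma kernel_monic:
  assumes "is_kernel C k f" shows "monic C k"
proof (rule monicI)
  have a: "f \<in> arr C" "k \<in> arr C" "tgt C k = src C f" using assms by (simp_all add: is_kernel_def)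
  have h: "k \<in> Hom (src C k) (src C f)" "f \<in> Hom (src C f) (tgt C f)" using a by (simp_all add: Hom_iff)
  show "k \<in> Hom (src C k) (src C f)" by fact
  fix T t assume t: "t \<in> Hom T (src C k)" "k \<cdot> t = Zero T (src C f)"
  have T: "T \<in> obj C" using t Hom_obj by blast
  have "Zero T (src C f) \<in> Hom T (src C f)" "f \<cdot> Zero T (src C f) = Zero T (tgt C f)"
    "Zero T (src C k) \<in> Hom T (src C k)" "k \<cdot> Zero T (src C k) = Zero T (src C f)"
    using T a by (simp_all add: Hom_iff)
  then show "t = Zero T (src C k)" using kernelD(3)[OF assms h] t by blast
qed

lemma kernelI:
  assumes k: "k \<in> Hom K X" and f: "f \<in> Hom X Y" and "f \<cdot> k = Zero K Y" and m: "monic C k"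
    and ex: "\<And>T g. \<lbrakk>g \<in> Hom T X; f \<cdot> g = Zero T Y\<rbrakk> \<Longrightarrow> \<exists>u\<in>Hom T K. k \<cdot> u = g"
  shows "is_kernel C k f"
  unfolding is_kernel_def
proof (intro conjI ballI impI)
  fix T g assume "T \<in> obj C" "g \<in> Hom T (src C f)" "f \<cdot> g = Zero T (tgt C f)"
  moreover have "src C f = X" "tgt C f = Y" using f by (simp_all add: Hom_iff)
  ultimately obtain u where u: "u \<in> Hom T K" "k \<cdot> u = g" using ex[of g T] by auto
  show "\<exists>!u. u \<in> Hom T (src C k) \<and> k \<cdot> u = g"
  proof (rule ex1I)
    show "u \<in> Hom T (src C k) \<and> k \<cdot> u = g" using u k by (simp add: Hom_iff)
    fix v assume "v \<in> Hom T (src C k) \<and> k \<cdot> v = g"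
    then have v: "v \<in> Hom T K" "k \<cdot> v = g" using k by (simp_all add: Hom_iff)
    show "v = u" by (rule monicD[OF m k v(1) u(1)]) (simp add: u v)
  qed
qed (use assms in \<open>auto simp: Hom_iff\<close>)

section \<open>Zero objects, retracts and biproducts\<close>

lemma zero_obj_iff: "zero_obj C Z \<longleftrightarrow> Z \<in> obj C \<and> Id Z = Zero Z Z"
proof
  assume z: "zero_obj C Z"
  then have "Z \<in> obj C" by (simp add: zero_obj_def)
  moreover have "Id Z \<in> Hom Z Z" "Zero Z Z \<in> Hom Z Z" using \<open>Z \<in> obj C\<close> by (simp_all add: Hom_iff)
  ultimately show "Z \<in> obj C \<and> Id Z = Zero Z Z" using z unfolding zero_obj_def by blast
next
  assume z: "Z \<in> obj C \<and> Id Z = Zero Z Z"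
  show "zero_obj C Z" unfolding zero_obj_def
  proof (intro conjI ballI ex1I)
    fix X f assume X: "X \<in> obj C"
    show "Zero Z X \<in> Hom Z X" "Zero X Z \<in> Hom X Z" using X z by (simp_all add: Hom_iff)
    show "f = Zero Z X" if "f \<in> Hom Z X"
      using that z id_cmp(2)[of f Z] zero_cmp(2)[of f Z Z] X by (auto simp: Hom_iff)
    show "f = Zero X Z" if "f \<in> Hom X Z"
      using that z id_cmp(1)[of f Z] zero_cmp(1)[of f Z Z] X by (auto simp: Hom_iff)
  qed (use z in simp)
qed

lemma direct_sum_pair: "direct_sum C X [A, B] \<longleftrightarrow> (\<exists>i j p q. biprod C X A B i j p q)"
proof
  assume d: "direct_sum C X [A, B]"
  then have [simp]: "X \<in> obj C" by (simp add: direct_sum_def)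
  interpret comm_group "hom_group C X X" by (rule hom_comm_group) simp_all
  have len: "length [A, B] = 2" by simp
  from d obtain \<iota> \<pi> where
    hom: "\<forall>k<2. \<iota> k \<in> Hom ([A, B] ! k) X \<and> \<pi> k \<in> Hom X ([A, B] ! k)" and
    orth: "\<forall>j<2. \<forall>k<2. \<pi> j \<cdot> \<iota> k =
      (if j = k then Id ([A, B] ! k) else Zero ([A, B] ! k) ([A, B] ! j))" and
    sum: "finprod (hom_group C X X) (\<lambda>k. \<iota> k \<cdot> \<pi> k) {..<2} = Id X"
    unfolding direct_sum_def len by blast
  note h0 = hom[rule_format, of 0, simplified] and h1 = hom[rule_format, of 1, simplified]
  have s: "{..<2::nat} = insert 0 {1}" by auto
  have "\<iota> 0 \<cdot> \<pi> 0 \<boxplus> \<iota> 1 \<cdot> \<pi> 1 = Id X"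
    using sum h0 h1 unfolding s by (subst (asm) finprod_insert) (auto simp: Hom_iff)
  then have "biprod C X A B (\<iota> 0) (\<iota> 1) (\<pi> 0) (\<pi> 1)"
    unfolding biprod_def using h0 h1 orth[rule_format, of 0 0] orth[rule_format, of 0 1] orth[rule_format, of 1 0]
      orth[rule_format, of 1 1] by simp
  then show "\<exists>i j p q. biprod C X A B i j p q" by blast
next
  assume "\<exists>i j p q. biprod C X A B i j p q"
  then obtain i j p q where b: "biprod C X A B i j p q" by blast
  note b' = b[unfolded biprod_def]
  have [simp]: "X \<in> obj C" "A \<in> obj C" "B \<in> obj C" using b' Hom_obj by auto
  interpret comm_group "hom_group C X X" by (rule hom_comm_group) simp_all
  let ?i = "\<lambda>k. if k = 0 then i else j" and ?p = "\<lambda>k. if k = (0::nat) then p else q"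
  have s: "{..<length [A, B]} = insert 0 {1::nat}" by auto
  have "finprod (hom_group C X X) (\<lambda>k. ?i k \<cdot> ?p k) {..<length [A, B]} = Id X"
    unfolding s using b' by (subst finprod_insert) (auto simp: Hom_iff)
  moreover have "k = 0 \<or> k = 1" if "k < length [A, B]" for k using that by auto
  ultimately show "direct_sum C X [A, B]"
    unfolding direct_sum_def using b'
    by (intro conjI exI[of _ ?i] exI[of _ ?p]) (auto simp: nth_Cons' Hom_iff)
qed

lemma biprodD:
  assumes "biprod C X A B i j p q"
  shows "X \<in> obj C" "A \<in> obj C" "B \<in> obj C"
    "i \<in> arr C" "src C i = A" "tgt C i = X" "j \<in> arr C" "src C j = B" "tgt C j = X"
    "p \<in> arr C" "src C p = X" "tgt C p = A" "q \<in> arr C" "src C q = X" "tgt C q = B"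
    "p \<cdot> i = Id A" "q \<cdot> j = Id B" "p \<cdot> j = Zero B A" "q \<cdot> i = Zero A B"
    "i \<cdot> p \<boxplus> j \<cdot> q = Id X"
    "\<And>x. \<lbrakk>x \<in> arr C; tgt C x = A\<rbrakk> \<Longrightarrow> p \<cdot> (i \<cdot> x) = x"
    "\<And>x. \<lbrakk>x \<in> arr C; tgt C x = B\<rbrakk> \<Longrightarrow> q \<cdot> (j \<cdot> x) = x"
    "\<And>x. \<lbrakk>x \<in> arr C; tgt C x = B\<rbrakk> \<Longrightarrow> p \<cdot> (j \<cdot> x) = Zero (src C x) A"
    "\<And>x. \<lbrakk>x \<in> arr C; tgt C x = A\<rbrakk> \<Longrightarrow> q \<cdot> (i \<cdot> x) = Zero (src C x) B"
proof -
  note b = assms[unfolded biprod_def]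
  show [simp]: "X \<in> obj C" "A \<in> obj C" "B \<in> obj C" using b Hom_obj by auto
  show [simp]: "i \<in> arr C" "src C i = A" "tgt C i = X" "j \<in> arr C" "src C j = B" "tgt C j = X"
    "p \<in> arr C" "src C p = X" "tgt C p = A" "q \<in> arr C" "src C q = X" "tgt C q = B"
    "p \<cdot> i = Id A" "q \<cdot> j = Id B" "p \<cdot> j = Zero B A" "q \<cdot> i = Zero A B"
    "i \<cdot> p \<boxplus> j \<cdot> q = Id X"
    using b by (auto simp: Hom_iff)
  show "\<And>x. \<lbrakk>x \<in> arr C; tgt C x = A\<rbrakk> \<Longrightarrow> p \<cdot> (i \<cdot> x) = x"
    "\<And>x. \<lbrakk>x \<in> arr C; tgt C x = B\<rbrakk> \<Longrightarrow> q \<cdot> (j \<cdot> x) = x"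
    "\<And>x. \<lbrakk>x \<in> arr C; tgt C x = B\<rbrakk> \<Longrightarrow> p \<cdot> (j \<cdot> x) = Zero (src C x) A"
    "\<And>x. \<lbrakk>x \<in> arr C; tgt C x = A\<rbrakk> \<Longrightarrow> q \<cdot> (i \<cdot> x) = Zero (src C x) B"
    by (simp_all flip: assoc)
qed

lemma biprod_sym: "biprod C X A B i j p q \<Longrightarrow> biprod C X B A j i q p"
  unfolding biprod_def using add_commute[of "i \<cdot> p" "j \<cdot> q"] by (auto simp: Hom_iff)

lemma biprod_split_in:
  assumes b: "biprod C X A B i j p q" and x: "x \<in> arr C" "tgt C x = X"
  shows "i \<cdot> (p \<cdot> x) \<boxplus> j \<cdot> (q \<cdot> x) = x"
proof -
  note [simp] = biprodD[OF b] x
  have "(i \<cdot> p \<boxplus> j \<cdot> q) \<cdot> x = x" by simp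
  then show ?thesis by (subst (asm) distrib) (simp_all add: assoc)
qed

lemma biprod_split_out:
  assumes b: "biprod C X A B i j p q" and x: "x \<in> arr C" "src C x = X"
  shows "(x \<cdot> i) \<cdot> p \<boxplus> (x \<cdot> j) \<cdot> q = x"
proof -
  note [simp] = biprodD[OF b] x
  have "x \<cdot> (i \<cdot> p \<boxplus> j \<cdot> q) = x" by simp
  then show ?thesis by (subst (asm) distrib) (simp_all add: assoc)
qed

lemma biprod_ext_in:
  assumes b: "biprod C X A B i j p q" and "x \<in> arr C" "tgt C x = X" "y \<in> arr C" "tgt C y = X"
    "p \<cdot> x = p \<cdot> y" "q \<cdot> x = q \<cdot> y"
  shows "x = y"
  using biprod_split_in[OF b] assms by metis

lemma biprod_ext_out:
  assumes b: "biprod C X A B i j p q" and "x \<in> arr C" "src C x = X" "y \<in> arr C" "src C y = X"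
    "x \<cdot> i = y \<cdot> i" "x \<cdot> j = y \<cdot> j"
  shows "x = y"
  using biprod_split_out[OF b] assms by metis

lemma biprod_retracts:
  assumes "biprod C X A B i j p q" shows "retract C A X" "retract C B X"
  using assms unfolding biprod_def retract_def by blast+

lemma direct_sum_sym: "direct_sum C X [A, B] \<Longrightarrow> direct_sum C X [B, A]"
  unfolding direct_sum_pair using biprod_sym by blast

lemma direct_sum_retracts: "direct_sum C X [A, B] \<Longrightarrow> retract C A X \<and> retract C B X"
  unfolding direct_sum_pair using biprod_retracts by blast

lemma direct_sum_obj: "direct_sum C X [A, B] \<Longrightarrow> X \<in> obj C \<and> A \<in> obj C \<and> B \<in> obj C"
  by (simp add: direct_sum_def)

lemma retract_obj: "retract C X M \<Longrightarrow> X \<in> obj C \<and> M \<in> obj C"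
  unfolding retract_def using Hom_obj by blast

lemma retract_trans:
  assumes "retract C X Y" "retract C Y Z" shows "retract C X Z"
proof -
  from assms obtain s r s' r' where
    h: "s \<in> Hom X Y" "r \<in> Hom Y X" "r \<cdot> s = Id X" "s' \<in> Hom Y Z" "r' \<in> Hom Z Y" "r' \<cdot> s' = Id Y"
    unfolding retract_def by blast
  have "(r \<cdot> r') \<cdot> (s' \<cdot> s) = Id X"
    using h cmp_reduce[OF h(6), of s] by (simp add: Hom_iff assoc)
  then show ?thesis unfolding retract_def using h by (meson cmp_hom)
qed

lemma isomorphic_retract: "isomorphic_obj C X Y \<Longrightarrow> retract C X Y"
  unfolding isomorphic_obj_def retract_def by blast

lemma isomorphic_sym: "isomorphic_obj C X Y \<Longrightarrow> isomorphic_obj C Y X"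
  unfolding isomorphic_obj_def by blast

lemma isomorphic_refl: "X \<in> obj C \<Longrightarrow> isomorphic_obj C X X"
  unfolding isomorphic_obj_def
  by (rule bexI[of _ "Id X"], rule bexI[of _ "Id X"]) (simp_all add: Hom_iff)

lemma isomorphic_trans:
  assumes "isomorphic_obj C X Y" "isomorphic_obj C Y Z" shows "isomorphic_obj C X Z"
proof -
  from assms obtain f g f' g' where
    h: "f \<in> Hom X Y" "g \<in> Hom Y X" "g \<cdot> f = Id X" "f \<cdot> g = Id Y"
     "f' \<in> Hom Y Z" "g' \<in> Hom Z Y" "g' \<cdot> f' = Id Y" "f' \<cdot> g' = Id Z"
    unfolding isomorphic_obj_def by blast
  have "(g \<cdot> g') \<cdot> (f' \<cdot> f) = Id X" "(f' \<cdot> f) \<cdot> (g \<cdot> g') = Id Z"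
    using h cmp_reduce[OF h(7), of f] cmp_reduce[OF h(4), of g'] by (simp_all add: Hom_iff assoc)
  then show ?thesis unfolding isomorphic_obj_def using h by (meson cmp_hom)
qed

lemma isomorphic_obj_obj: "isomorphic_obj C X Y \<Longrightarrow> X \<in> obj C \<and> Y \<in> obj C"
  unfolding isomorphic_obj_def using Hom_obj by blast

lemma retract_zero:
  assumes "retract C X Z" "zero_obj C Z" shows "zero_obj C X"
proof -
  obtain s r where h: "s \<in> Hom X Z" "r \<in> Hom Z X" "r \<cdot> s = Id X"
    using assms unfolding retract_def by blast
  have z: "Z \<in> obj C" "Id Z = Zero Z Z" using assms by (auto simp: zero_obj_iff)
  have "r \<cdot> (Id Z \<cdot> s) = Zero X X" unfolding z(2) using h z(1) Hom_obj[OF h(1)] by (simp add: Hom_iff)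
  then show ?thesis using h Hom_obj by (auto simp: zero_obj_iff Hom_iff)
qed

lemma direct_sum_zero_left:
  assumes "direct_sum C X [Z, A]" "zero_obj C Z" shows "isomorphic_obj C X A"
proof -
  obtain i j p q where b: "biprod C X Z A i j p q" using assms direct_sum_pair by blast
  note [simp] = biprodD[OF b]
  have z: "Id Z = Zero Z Z" using assms by (auto simp: zero_obj_iff)
  have "i \<cdot> (Id Z \<cdot> p) = Zero X X" unfolding z by simp
  then have "i \<cdot> p = Zero X X" by simp
  then have "j \<cdot> q = Id X" using biprodD(20)[OF b] by simp
  then show ?thesis unfolding isomorphic_obj_def
    by (intro bexI[of _ q] bexI[of _ j]) (simp_all add: Hom_iff)
qed

lemma direct_sum_isomorphic:
  assumes "direct_sum C X [A, B]" "isomorphic_obj C X X'" shows "direct_sum C X' [A, B]"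
proof -
  obtain i j p q where b: "biprod C X A B i j p q" using assms direct_sum_pair by blast
  obtain f g where h: "f \<in> Hom X X'" "g \<in> Hom X' X" "g \<cdot> f = Id X" "f \<cdot> g = Id X'"
    using assms unfolding isomorphic_obj_def by blast
  note [simp] = biprodD[OF b] h(1,2)[unfolded Hom_iff] h(3,4)
  have r: "g \<cdot> (f \<cdot> x) = x" if "x \<in> arr C" "tgt C x = X" for x
    using that cmp_reduce[OF h(3), of x] by simp
  have "f \<cdot> ((i \<cdot> p \<boxplus> j \<cdot> q) \<cdot> g) = Id X'" by simp
  then have "(f \<cdot> i) \<cdot> (p \<cdot> g) \<boxplus> (f \<cdot> j) \<cdot> (q \<cdot> g) = Id X'"
    by (simp add: distrib assoc del: biprodD(20)[OF b])
  then have "biprod C X' A B (f \<cdot> i) (f \<cdot> j) (p \<cdot> g) (q \<cdot> g)"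
    unfolding biprod_def by (simp add: Hom_iff assoc r)
  then show ?thesis unfolding direct_sum_pair by blast
qed

text \<open>
  The inclusion and the projection of the first summand are kept explicit: the exchange argument
  for local summands composes them with maps of another decomposition.
\<close>

lemma biprod_assoc:
  assumes b1: "biprod C X A B i j p q" and b2: "biprod C A Y K i' j' p' q'" and "direct_sum C W [K, B]"
  shows "\<exists>l r. biprod C X Y W (i \<cdot> i') l (p' \<cdot> p) r"
proof -
  obtain k l m n where b3: "biprod C W K B k l m n" using assms direct_sum_pair by blast
  note [simp] = biprodD[OF b1] biprodD[OF b2] biprodD[OF b3]
  have 1: "i \<cdot> ((i' \<cdot> p' \<boxplus> j' \<cdot> q') \<cdot> p) \<boxplus> j \<cdot> q = Id X" by simp
  have 2: "k \<cdot> m \<boxplus> l \<cdot> n = Id W" by simp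
  let ?i = "i \<cdot> i'" and ?j = "i \<cdot> (j' \<cdot> m) \<boxplus> j \<cdot> n"
  let ?p = "p' \<cdot> p" and ?q = "k \<cdot> (q' \<cdot> p) \<boxplus> l \<cdot> q"
  have "?i \<cdot> ?p \<boxplus> ?j \<cdot> ?q = Id X"
    using 1 by (simp add: distrib assoc add_ac del: biprodD(20)[OF b1] biprodD(20)[OF b2])
  moreover have "?q \<cdot> ?j = Id W"
    by (simp add: distrib assoc)
  ultimately have "biprod C X Y W ?i ?j ?p ?q"
    unfolding biprod_def by (simp add: Hom_iff distrib assoc)
  then show ?thesis by blast
qed

lemma direct_sum_assoc:
  assumes "direct_sum C X [A, B]" "direct_sum C A [Y, K]" "direct_sum C W [K, B]"
  shows "direct_sum C X [Y, W]"
  using assms(1,2) biprod_assoc[OF _ _ assms(3)] unfolding direct_sum_pair by blast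

text \<open>
  Gaussian elimination: writing the identity of \<open>X\<close> as a matrix between two decompositions, an
  invertible entry can be cleared, and the Schur complement is an isomorphism between the
  complementary summands.
\<close>

lemma complements_isomorphic:
  assumes b: "biprod C X Y K i j p q" and b': "biprod C X Z K' i' j' p' q'"
    and d: "iso_arr C (p' \<cdot> i)"
  shows "isomorphic_obj C K K'"
proof -
  note [simp] = biprodD[OF b] biprodD[OF b']
  obtain d' where d': "d' \<in> Hom Z Y" "d' \<cdot> (p' \<cdot> i) = Id Y" "(p' \<cdot> i) \<cdot> d' = Id Z"
    using d unfolding iso_arr_def by auto
  note [simp] = d'(1)[unfolded Hom_iff] d'(2)
  have d3 [simp]: "p' \<cdot> (i \<cdot> d') = Id Z" using d'(3) by (simp add: assoc)
  \<comment> \<open>The projection of \<open>X\<close> that kills the image of \<open>i\<close> and has image the kernel of \<open>p'\<close>.\<close>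
  define e where "e = Id X \<boxplus> Neg (i \<cdot> (d' \<cdot> p'))"
  have [simp]: "e \<in> arr C" "src C e = X" "tgt C e = X" by (simp_all add: e_def)
  have pe: "p' \<cdot> e = Zero X Z"
    using cmp_reduce[OF d3, of p'] by (simp add: e_def distrib neg_cmp assoc)
  have ei: "e \<cdot> i = Zero Y X" by (simp add: e_def distrib neg_cmp assoc)
  have qe: "q \<cdot> (e \<cdot> j) = Id K" by (simp add: e_def distrib neg_cmp assoc)
  have qe': "q' \<cdot> (e \<cdot> j') = Id K'" by (simp add: e_def distrib neg_cmp assoc)
  let ?f = "q' \<cdot> (e \<cdot> j)" and ?g = "q \<cdot> j'"
  have "?g \<cdot> ?f = q \<cdot> ((j' \<cdot> (q' \<cdot> e)) \<cdot> j)" by (simp add: assoc)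
  also have "j' \<cdot> (q' \<cdot> e) = e" using biprod_split_in[OF b', of e] by (simp add: pe)
  finally have gf: "?g \<cdot> ?f = Id K" using qe by simp
  have "?f \<cdot> ?g = q' \<cdot> (((e \<cdot> j) \<cdot> q) \<cdot> j')" by (simp add: assoc)
  also have "(e \<cdot> j) \<cdot> q = e" using biprod_split_out[OF b, of e] by (simp add: ei)
  finally have "?f \<cdot> ?g = Id K'" using qe' by simp
  then show ?thesis unfolding isomorphic_obj_def using gf
    by (intro bexI[of _ ?f] bexI[of _ ?g]) (simp_all add: Hom_iff)
qed

end


section \<open>Splittings, pullbacks and syzygies\<close>

context preadditive_category
begin

lemma finprod_sandwich:
  assumes "finite A" "\<And>a. a \<in> A \<Longrightarrow> f a \<in> Hom X X" "u \<in> Hom X Y" "v \<in> Hom Z X"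
  shows "finprod (hom_group C Z Y) (\<lambda>a. u \<cdot> (f a \<cdot> v)) A = u \<cdot> (finprod (hom_group C X X) f A \<cdot> v)"
  using assms(1,2)
proof (induction A rule: finite_induct)
  case empty
  then show ?case using assms(3,4) Hom_obj[OF assms(3)] Hom_obj[OF assms(4)]
    by (simp add: finprod_def Hom_iff)
next
  case (insert a A)
  note [simp] = assms(3,4)[unfolded Hom_iff]
  have [simp]: "X \<in> obj C" "Y \<in> obj C" "Z \<in> obj C"
    using Hom_obj[OF assms(3)] Hom_obj[OF assms(4)] by auto
  interpret X: comm_group "hom_group C X X" by (rule hom_comm_group) simp_all
  interpret ZY: comm_group "hom_group C Z Y" by (rule hom_comm_group) simp_all
  have f: "f b \<in> arr C" "src C (f b) = X" "tgt C (f b) = X" if "b \<in> insert a A" for b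
    using insert.prems[OF that] by (auto simp: Hom_iff)
  have fA: "finprod (hom_group C X X) f A \<in> Hom X X"
    using X.finprod_closed[of f A] insert.prems by (auto simp: Pi_iff)
  have "finprod (hom_group C Z Y) (\<lambda>a. u \<cdot> (f a \<cdot> v)) (insert a A)
      = u \<cdot> (f a \<cdot> v) \<boxplus> finprod (hom_group C Z Y) (\<lambda>a. u \<cdot> (f a \<cdot> v)) A"
    using insert.hyps f by (subst ZY.finprod_insert) (auto simp: Hom_iff)
  also have "\<dots> = u \<cdot> (f a \<cdot> v) \<boxplus> u \<cdot> (finprod (hom_group C X X) f A \<cdot> v)"
    using insert by simp
  also have "\<dots> = u \<cdot> ((f a \<boxplus> finprod (hom_group C X X) f A) \<cdot> v)"
    using fA f by (simp add: Hom_iff distrib)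
  also have "f a \<boxplus> finprod (hom_group C X X) f A = finprod (hom_group C X X) f (insert a A)"
    using insert.hyps insert.prems by (subst X.finprod_insert) (auto simp: Pi_iff)
  finally show ?case .
qed

lemma zero_projective:
  assumes "zero_obj C Z" shows "Z \<in> projectives C"
proof -
  have "e \<cdot> Zero Z (src C e) = f" if "epic C e" "f \<in> Hom Z (tgt C e)" for e f
  proof -
    have e: "e \<in> arr C" using that by (simp add: epic_def)
    have z: "Z \<in> obj C" using assms by (simp add: zero_obj_def)
    have "\<exists>!f. f \<in> Hom Z (tgt C e)" using assms e by (simp add: zero_obj_def)
    moreover have "e \<cdot> Zero Z (src C e) \<in> Hom Z (tgt C e)" using e z by (simp add: Hom_iff)
    ultimately show ?thesis using that by blast
  qed
  moreover have "Zero Z (src C e) \<in> Hom Z (src C e)" if "epic C e" for e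
    using that assms by (simp add: Hom_iff epic_def zero_obj_def)
  ultimately show ?thesis
    using assms unfolding projectives_def zero_obj_def by blast
qed

lemma projective_lift:
  assumes "P \<in> projectives C" "epic C e" "e \<in> Hom X Y" "f \<in> Hom P Y"
  shows "\<exists>g\<in>Hom P X. e \<cdot> g = f"
proof -
  have "src C e = X" "tgt C e = Y" using assms by (simp_all add: Hom_iff)
  then show ?thesis using assms unfolding projectives_def by blast
qed

lemma projective_obj: "P \<in> projectives C \<Longrightarrow> P \<in> obj C"
  by (simp add: projectives_def)

lemma projectiveI:
  assumes "P \<in> obj C"
    "\<And>e f X Y. \<lbrakk>epic C e; e \<in> Hom X Y; f \<in> Hom P Y\<rbrakk> \<Longrightarrow> \<exists>g\<in>Hom P X. e \<cdot> g = f"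
  shows "P \<in> projectives C"
  unfolding projectives_def
proof (intro CollectI conjI allI impI)
  fix e f assume a: "epic C e \<and> f \<in> Hom P (tgt C e)"
  then show "\<exists>g\<in>Hom P (src C e). e \<cdot> g = f"
    by (intro assms(2)[of e "src C e" "tgt C e" f]) (auto simp: Hom_iff epic_def)
qed (rule assms(1))

lemma retract_projective:
  assumes "retract C X P" "P \<in> projectives C" shows "X \<in> projectives C"
proof (rule projectiveI)
  show "X \<in> obj C" using retract_obj[OF assms(1)] by simp
  obtain s r where sr: "s \<in> Hom X P" "r \<in> Hom P X" "r \<cdot> s = Id X"
    using assms unfolding retract_def by blast
  fix e f A B assume e: "epic C e" "e \<in> Hom A B" "f \<in> Hom X B"
  obtain g where g: "g \<in> Hom P A" "e \<cdot> g = f \<cdot> r"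
    using projective_lift[OF assms(2) e(1,2) cmp_hom[OF sr(2) e(3)]] by blast
  have "e \<cdot> (g \<cdot> s) = f"
    using cmp_reduce[OF g(2), of s] sr e g(1) by (simp add: Hom_iff assoc)
  then show "\<exists>g\<in>Hom X A. e \<cdot> g = f" using cmp_hom[OF sr(1) g(1)] by blast
qed

lemma direct_sum_projective:
  assumes "direct_sum C X [A, B]" "A \<in> projectives C" "B \<in> projectives C"
  shows "X \<in> projectives C"
proof -
  obtain i j p q where b: "biprod C X A B i j p q" using assms direct_sum_pair by blast
  note [simp] = biprodD[OF b]
  show ?thesis
  proof (rule projectiveI)
    fix e f S T assume e: "epic C e" "e \<in> Hom S T" "f \<in> Hom X T"
    note [simp] = e(2,3)[unfolded Hom_iff]
    obtain g where g: "g \<in> Hom A S" "e \<cdot> g = f \<cdot> i"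
      using projective_lift[OF assms(2) e(1,2), of "f \<cdot> i"] by (auto simp: Hom_iff)
    obtain h where h: "h \<in> Hom B S" "e \<cdot> h = f \<cdot> j"
      using projective_lift[OF assms(3) e(1,2), of "f \<cdot> j"] by (auto simp: Hom_iff)
    note [simp] = g(1)[unfolded Hom_iff] h(1)[unfolded Hom_iff]
    have "e \<cdot> (g \<cdot> p \<boxplus> h \<cdot> q) = (f \<cdot> i) \<cdot> p \<boxplus> (f \<cdot> j) \<cdot> q"
      by (simp add: distrib g(2) h(2) flip: assoc)
    also have "\<dots> = f" by (rule biprod_split_out[OF b]) simp_all
    finally show "\<exists>g\<in>Hom X S. e \<cdot> g = f"
      by (intro bexI[of _ "g \<cdot> p \<boxplus> h \<cdot> q"]) (simp_all add: Hom_iff)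
  qed simp
qed

end

context additive_category
begin

lemma ex_projective: "\<exists>Z. Z \<in> projectives C"
  using ex_zero_obj zero_projective by blast

end

context abelian_category
begin

text \<open>Kernels split idempotents: the complement of a retract is the kernel of the retraction.\<close>

lemma retract_biprod:
  assumes s: "s \<in> Hom X M" and r: "r \<in> Hom M X" and rs: "r \<cdot> s = Id X"
  shows "\<exists>K k u. biprod C M X K s k r u"
proof -
  note [simp] = s[unfolded Hom_iff] r[unfolded Hom_iff] rs
  have [simp]: "X \<in> obj C" "M \<in> obj C" using Hom_obj[OF s] by auto
  obtain k where ker: "is_kernel C k r" using ex_kernel[of r] by auto
  define K where "K = src C k"
  have k: "k \<in> Hom K M" using ker by (simp add: is_kernel_def Hom_iff K_def)
  note [simp] = k[unfolded Hom_iff]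
  have [simp]: "K \<in> obj C" using Hom_obj[OF k] by simp
  have m: "monic C k" by (rule kernel_monic[OF ker])
  have rk: "r \<cdot> k = Zero K X" by (rule kernelD(1)[OF ker k r])
  have rsx: "r \<cdot> (s \<cdot> x) = x" if "x \<in> arr C" "tgt C x = X" for x
    using that cmp_reduce[OF rs, of x] by simp
  \<comment> \<open>The idempotent complementary to \<open>s \<cdot> r\<close> factors through the kernel of \<open>r\<close>.\<close>
  let ?e = "Id M \<boxplus> Neg (s \<cdot> r)"
  have "r \<cdot> ?e = Zero M X" by (simp add: distrib neg_cmp rsx)
  then obtain u where u: "u \<in> Hom M K" "k \<cdot> u = ?e"
    using kernelD(2)[OF ker k r, of ?e M] by (auto simp: Hom_iff)
  note [simp] = u(1)[unfolded Hom_iff]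
  have ku: "k \<cdot> (u \<cdot> x) = ?e \<cdot> x" if "x \<in> arr C" "tgt C x = M" for x
    using that cmp_reduce[OF u(2), of x] by simp
  have "k \<cdot> (u \<cdot> s) = Zero X M" by (subst ku) (simp_all add: distrib neg_cmp assoc)
  then have us: "u \<cdot> s = Zero X K" by (intro monic_zeroD[OF m k]) (simp_all add: Hom_iff)
  have "k \<cdot> (u \<cdot> k) = k \<cdot> Id K" by (subst ku) (simp_all add: distrib neg_cmp assoc rk)
  then have uk: "u \<cdot> k = Id K" by (rule monicD[OF m k, rotated -1]) (simp_all add: Hom_iff)
  have "s \<cdot> r \<boxplus> k \<cdot> u = Id M"
    unfolding u(2) using add_left_commute[of "s \<cdot> r" "Id M" "Neg (s \<cdot> r)"] by simp
  then have "biprod C M X K s k r u"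
    unfolding biprod_def using rk us uk k u(1) s r by simp
  then show ?thesis by blast
qed

lemma retract_direct_sum: "retract C X M \<Longrightarrow> \<exists>K. direct_sum C M [X, K]"
  unfolding retract_def direct_sum_pair using retract_biprod by blast

text \<open>
  The complement of the first summand is the kernel of its projection. The inclusions of the other
  summands factor through this kernel, so no direct sum of the remaining list has to be constructed.
\<close>

lemma direct_sum_Cons:
  assumes "direct_sum C X (Y # Ys)"
  shows "\<exists>K. direct_sum C X [Y, K] \<and> direct_sum C K Ys"
proof -
  have [simp]: "X \<in> obj C" using assms by (simp add: direct_sum_def)
  interpret X: comm_group "hom_group C X X" by (rule hom_comm_group) simp_all
  obtain \<iota> \<pi> where
    hom: "\<forall>k<length (Y # Ys). \<iota> k \<in> Hom ((Y # Ys) ! k) X \<and> \<pi> k \<in> Hom X ((Y # Ys) ! k)" and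
    orth: "\<forall>j<length (Y # Ys). \<forall>k<length (Y # Ys). \<pi> j \<cdot> \<iota> k =
      (if j = k then Id ((Y # Ys) ! k) else Zero ((Y # Ys) ! k) ((Y # Ys) ! j))" and
    sum: "finprod (hom_group C X X) (\<lambda>k. \<iota> k \<cdot> \<pi> k) {..<length (Y # Ys)} = Id X"
    using assms unfolding direct_sum_def by blast
  have Y: "set (Y # Ys) \<subseteq> obj C" using assms by (simp add: direct_sum_def)
  have h0: "\<iota> 0 \<in> Hom Y X" "\<pi> 0 \<in> Hom X Y" using hom by auto
  have o0: "\<pi> 0 \<cdot> \<iota> 0 = Id Y" using orth by auto
  obtain K k u where b: "biprod C X Y K (\<iota> 0) k (\<pi> 0) u" using retract_biprod[OF h0 o0] by blast
  note [simp] = biprodD[OF b]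
  interpret K: comm_group "hom_group C K K" by (rule hom_comm_group) simp_all
  have h: "\<iota> (Suc l) \<in> arr C" "src C (\<iota> (Suc l)) = Ys ! l" "tgt C (\<iota> (Suc l)) = X"
    "\<pi> (Suc l) \<in> arr C" "src C (\<pi> (Suc l)) = X" "tgt C (\<pi> (Suc l)) = Ys ! l"
    "Ys ! l \<in> obj C"
    if "l < length Ys" for l
    using hom[rule_format, of "Suc l"] that Y by (auto simp: Hom_iff)
  let ?i = "\<lambda>l. u \<cdot> \<iota> (Suc l)" and ?p = "\<lambda>l. \<pi> (Suc l) \<cdot> k"
  have ku: "k \<cdot> (u \<cdot> \<iota> (Suc l)) = \<iota> (Suc l)" if "l < length Ys" for l
    using biprod_split_in[OF b, of "\<iota> (Suc l)"] h[OF that] orth[rule_format, of 0 "Suc l"] that by simp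
  have "?p l \<cdot> ?i m = (if l = m then Id (Ys ! m) else Zero (Ys ! m) (Ys ! l))"
    if "l < length Ys" "m < length Ys" for l m
    using orth[rule_format, of "Suc l" "Suc m"] that h by (simp add: assoc ku)
  moreover have "finprod (hom_group C K K) (\<lambda>l. ?i l \<cdot> ?p l) {..<length Ys} = Id K"
  proof -
    let ?S = "finprod (hom_group C X X) (\<lambda>l. \<iota> (Suc l) \<cdot> \<pi> (Suc l)) {..<length Ys}"
    have S: "?S \<in> Hom X X" using X.finprod_closed[of "\<lambda>l. \<iota> (Suc l) \<cdot> \<pi> (Suc l)" "{..<length Ys}"] h
      by (simp add: Pi_iff Hom_iff)
    have "Id X = finprod (hom_group C X X) (\<lambda>k. \<iota> k \<cdot> \<pi> k) (insert 0 (Suc ` {..<length Ys}))"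
      using sum by (simp add: lessThan_Suc_eq_insert_0)
    also have "\<dots> = \<iota> 0 \<cdot> \<pi> 0 \<boxplus> finprod (hom_group C X X) (\<lambda>k. \<iota> k \<cdot> \<pi> k) (Suc ` {..<length Ys})"
      using h by (subst X.finprod_insert) (auto simp: Hom_iff)
    also have "finprod (hom_group C X X) (\<lambda>k. \<iota> k \<cdot> \<pi> k) (Suc ` {..<length Ys}) = ?S"
      using h by (subst X.finprod_reindex) (auto simp: Hom_iff)
    finally have 1: "Id X = \<iota> 0 \<cdot> \<pi> 0 \<boxplus> ?S" .
    have "Id K = u \<cdot> (Id X \<cdot> k)" by simp
    also have "\<dots> = u \<cdot> (?S \<cdot> k)"
      unfolding 1 using S by (simp add: Hom_iff distrib assoc)
    also have "\<dots> = finprod (hom_group C K K) (\<lambda>l. u \<cdot> ((\<iota> (Suc l) \<cdot> \<pi> (Suc l)) \<cdot> k)) {..<length Ys}"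
      using h by (subst finprod_sandwich) (auto simp: Hom_iff)
    also have "\<dots> = finprod (hom_group C K K) (\<lambda>l. ?i l \<cdot> ?p l) {..<length Ys}"
      using h by (intro K.finprod_cong') (auto simp: Hom_iff assoc)
    finally show ?thesis by simp
  qed
  moreover have "?i l \<in> Hom (Ys ! l) K \<and> ?p l \<in> Hom K (Ys ! l)" if "l < length Ys" for l
    using h that by (simp add: Hom_iff)
  ultimately have "direct_sum C K Ys"
    unfolding direct_sum_def using Y by (intro conjI exI[of _ ?i] exI[of _ ?p]) auto
  then show ?thesis using b direct_sum_pair by blast
qed

lemma direct_sum_Nil: "direct_sum C X [] \<Longrightarrow> zero_obj C X"
proof -
  assume d: "direct_sum C X []"
  then have X: "X \<in> obj C" by (simp add: direct_sum_def)
  interpret comm_group "hom_group C X X" by (rule hom_comm_group[OF X X])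
  show "zero_obj C X" using d X by (auto simp: direct_sum_def zero_obj_iff)
qed

text \<open>
  The morphism that \<open>f\<close> is a cokernel of factors through the kernel of \<open>f\<close>, so a morphism that
  vanishes on the kernel factors through \<open>f\<close>.
\<close>

lemma epic_cokernel_of_kernel:
  assumes "epic C f" "is_kernel C k f" and f: "f \<in> Hom X Y" and k: "k \<in> Hom K X"
  shows "is_cokernel C f k"
proof -
  obtain h where ch: "is_cokernel C f h" using epic_normal[OF assms(1)] by blast
  have h: "h \<in> Hom (src C h) X"
    using ch f unfolding is_cokernel_def Hom_iff by metis
  have fh: "f \<cdot> h = Zero (src C h) Y" by (rule cokernelD(1)[OF ch h f])
  obtain u where u: "u \<in> Hom (src C h) K" "k \<cdot> u = h"
    using kernelD(2)[OF assms(2) k f h fh] by blast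
  have ex: "\<exists>!u. u \<in> Hom Y T \<and> u \<cdot> f = g" if g: "g \<in> Hom X T" "g \<cdot> k = Zero K T" for g T
  proof -
    note [simp] = g(1)[unfolded Hom_iff] k[unfolded Hom_iff] u(1)[unfolded Hom_iff]
    have "g \<cdot> (k \<cdot> u) = Zero (src C h) T"
      using cmp_reduce[OF g(2), of u] Hom_obj[OF g(1)] by simp
    then have "g \<cdot> h = Zero (src C h) T" by (simp only: u(2))
    then show ?thesis by (rule cokernelD(2)[OF ch h f g(1)])
  qed
  have "f \<in> arr C" "k \<in> arr C" "src C f = X" "tgt C f = Y" "src C k = K" "tgt C k = X"
    using f k by (simp_all add: Hom_iff)
  then show ?thesis
    using ex kernelD(1)[OF assms(2) k f] unfolding is_cokernel_def by simp
qed

text \<open>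
  The pullback of \<open>f\<close> along \<open>g\<close> is realised as the kernel of \<open>f \<cdot> p \<boxplus> g \<cdot> q\<close> on a biproduct. The
  missing sign is harmless, as only kernels and epimorphisms matter, and it keeps the
  construction symmetric in \<open>f\<close> and \<open>g\<close>.
\<close>

lemma pullback_half:
  assumes b: "biprod C S A B i j p q" and f: "f \<in> Hom A M" "epic C f" and g: "g \<in> Hom B M"
    and e: "is_kernel C e (f \<cdot> p \<boxplus> g \<cdot> q)" and k: "is_kernel C k f" "k \<in> Hom K A"
  shows "epic C (q \<cdot> e)" "\<exists>k'\<in>Hom K (src C e). is_kernel C k' (q \<cdot> e)"
proof -
  note [simp] = biprodD[OF b] f(1)[unfolded Hom_iff] g[unfolded Hom_iff] k(2)[unfolded Hom_iff]
  have [simp]: "M \<in> obj C" "K \<in> obj C" using Hom_obj f k by auto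
  let ?f = "f \<cdot> p \<boxplus> g \<cdot> q"
  have fi: "?f \<cdot> i = f" and fj: "?f \<cdot> j = g" by (simp_all add: distrib assoc)
  have fh: "?f \<in> Hom S M" by (simp add: Hom_iff)
  define E where "E = src C e"
  have eh: "e \<in> Hom E S" using e by (simp add: is_kernel_def E_def Hom_iff)
  note [simp] = eh[unfolded Hom_iff]
  have [simp]: "E \<in> obj C" using Hom_obj[OF eh] by simp
  have fe: "?f \<cdot> e = Zero E M" by (rule kernelD(1)[OF e eh fh])
  have epi: "epic C ?f"
  proof (rule epicI[OF fh])
    fix T t assume t: "t \<in> Hom M T" "t \<cdot> ?f = Zero S T"
    note [simp] = t(1)[unfolded Hom_iff]
    have [simp]: "T \<in> obj C" using Hom_obj[OF t(1)] by simp
    have "t \<cdot> f = (t \<cdot> ?f) \<cdot> i" by (simp add: fi assoc)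
    also have "\<dots> = Zero A T" unfolding t(2) by simp
    finally show "t = Zero M T" by (rule epic_zeroD[OF f(2,1) t(1)])
  qed
  have cok: "is_cokernel C ?f e" by (rule epic_cokernel_of_kernel[OF epi e fh eh])
  show "epic C (q \<cdot> e)"
  proof (rule epicI)
    show "q \<cdot> e \<in> Hom E B" by (simp add: Hom_iff)
    fix T t assume t: "t \<in> Hom B T" "t \<cdot> (q \<cdot> e) = Zero E T"
    note [simp] = t(1)[unfolded Hom_iff]
    have [simp]: "T \<in> obj C" using Hom_obj[OF t(1)] by simp
    have "(t \<cdot> q) \<cdot> e = Zero E T" using t(2) by (simp add: assoc)
    moreover have "t \<cdot> q \<in> Hom S T" by (simp add: Hom_iff)
    ultimately obtain w where w: "w \<in> Hom M T" "w \<cdot> ?f = t \<cdot> q"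
      using cokernelD(2)[OF cok eh fh] by blast
    note [simp] = w(1)[unfolded Hom_iff]
    have wx: "w \<cdot> (?f \<cdot> x) = t \<cdot> (q \<cdot> x)" if "x \<in> arr C" "tgt C x = S" for x
      using cmp_reduce[OF w(2), of x] that by (simp add: assoc)
    have "w \<cdot> f = Zero A T" using wx[of i] by (simp add: fi)
    then have "w = Zero M T" by (rule epic_zeroD[OF f(2,1) w(1)])
    then show "t = Zero B T" using wx[of j] by (simp add: fj)
  qed
  have fk: "f \<cdot> k = Zero K M" by (rule kernelD(1)[OF k f(1)])
  have "?f \<cdot> (i \<cdot> k) = Zero K M" using cmp_reduce[OF fi, of k] by (simp add: fk)
  then obtain k' where k': "k' \<in> Hom K E" "e \<cdot> k' = i \<cdot> k"
    using kernelD(2)[OF e eh fh, of "i \<cdot> k" K] by (auto simp: Hom_iff)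
  note [simp] = k'(1)[unfolded Hom_iff]
  have "is_kernel C k' (q \<cdot> e)"
  proof (rule kernelI)
    show "k' \<in> Hom K E" "q \<cdot> e \<in> Hom E B" by (simp_all add: Hom_iff)
    show "(q \<cdot> e) \<cdot> k' = Zero K B" by (simp add: assoc k'(2))
    show "monic C k'"
    proof (rule monicI[OF k'(1)])
      fix T t assume t: "t \<in> Hom T K" "k' \<cdot> t = Zero T E"
      note [simp] = t(1)[unfolded Hom_iff]
      have [simp]: "T \<in> obj C" using Hom_obj[OF t(1)] by simp
      have "i \<cdot> (k \<cdot> t) = Zero T S" using cmp_reduce[OF k'(2), of t] by (simp add: t(2) assoc)
      then have "p \<cdot> (i \<cdot> (k \<cdot> t)) = Zero T A" by (simp only: \<open>i \<cdot> (k \<cdot> t) = _\<close>) simp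
      then have "k \<cdot> t = Zero T A" by simp
      then show "t = Zero T K" by (rule monic_zeroD[OF kernel_monic[OF k(1)] k(2) t(1)])
    qed
    fix T x assume x: "x \<in> Hom T E" "(q \<cdot> e) \<cdot> x = Zero T B"
    note [simp] = x(1)[unfolded Hom_iff]
    have [simp]: "T \<in> obj C" using Hom_obj[OF x(1)] by simp
    have qex: "q \<cdot> (e \<cdot> x) = Zero T B" using x(2) by (simp add: assoc)
    have "?f \<cdot> (e \<cdot> x) = Zero T M" using cmp_reduce[OF fe, of x] by simp
    then have "f \<cdot> (p \<cdot> (e \<cdot> x)) = Zero T M" by (simp add: distrib assoc qex)
    then obtain y where y: "y \<in> Hom T K" "k \<cdot> y = p \<cdot> (e \<cdot> x)"
      using kernelD(2)[OF k f(1), of "p \<cdot> (e \<cdot> x)" T] by (auto simp: Hom_iff)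
    note [simp] = y(1)[unfolded Hom_iff]
    have "e \<cdot> (k' \<cdot> y) = i \<cdot> (k \<cdot> y)" using cmp_reduce[OF k'(2), of y] by (simp add: assoc)
    also have "\<dots> = e \<cdot> x"
      using biprod_split_in[OF b, of "e \<cdot> x"] by (simp add: y(2) qex)
    finally have "k' \<cdot> y = x" by (rule monicD[OF kernel_monic[OF e] eh, rotated -1]) (simp_all add: Hom_iff)
    then show "\<exists>u\<in>Hom T K. k' \<cdot> u = x" using y(1) by blast
  qed
  then show "\<exists>k'\<in>Hom K (src C e). is_kernel C k' (q \<cdot> e)" using k'(1) E_def by blast
qed

lemma pullback:
  assumes f: "f \<in> Hom A M" "epic C f" and g: "g \<in> Hom B M" "epic C g"
    and k: "is_kernel C k f" "k \<in> Hom K A" and l: "is_kernel C l g" "l \<in> Hom L B"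
  shows "\<exists>E. (\<exists>a\<in>Hom E A. epic C a \<and> (\<exists>l'\<in>Hom L E. is_kernel C l' a)) \<and>
             (\<exists>b\<in>Hom E B. epic C b \<and> (\<exists>k'\<in>Hom K E. is_kernel C k' b))"
proof -
  obtain S where "direct_sum C S [A, B]" using ex_direct_sum Hom_obj f g by blast
  then obtain i j p q where b: "biprod C S A B i j p q" using direct_sum_pair by blast
  note [simp] = biprodD[OF b] f(1)[unfolded Hom_iff] g(1)[unfolded Hom_iff]
  obtain e where e: "is_kernel C e (f \<cdot> p \<boxplus> g \<cdot> q)" using ex_kernel by fastforce
  have e': "is_kernel C e (g \<cdot> q \<boxplus> f \<cdot> p)" using e add_commute[of "f \<cdot> p" "g \<cdot> q"] by simp
  have [simp]: "e \<in> arr C" "tgt C e = S" using e by (simp_all add: is_kernel_def)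
  have "p \<cdot> e \<in> Hom (src C e) A" "q \<cdot> e \<in> Hom (src C e) B" by (simp_all add: Hom_iff)
  then show ?thesis
    using pullback_half[OF b f g(1) e k] pullback_half[OF biprod_sym[OF b] g f(1) e' l] by blast
qed

lemma projective_quotient_splits:
  assumes "P \<in> projectives C" "e \<in> Hom X P" "epic C e" "is_kernel C k e" "k \<in> Hom K X"
  shows "direct_sum C X [P, K]"
proof -
  have P: "P \<in> obj C" using projective_obj assms(1) by blast
  note [simp] = assms(2,5)[unfolded Hom_iff] P
  have [simp]: "K \<in> obj C" using Hom_obj[OF assms(5)] by simp
  have "Id P \<in> Hom P P" by (simp add: Hom_iff)
  then obtain s where s: "s \<in> Hom P X" "e \<cdot> s = Id P"
    using projective_lift[OF assms(1,3,2)] by blast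
  obtain K' k' u where b: "biprod C X P K' s k' e u" using retract_biprod[OF s(1) assms(2) s(2)] by blast
  note [simp] = biprodD[OF b]
  \<comment> \<open>Both \<open>k\<close> and \<open>k'\<close> are kernels of \<open>e\<close>.\<close>
  obtain v where v: "v \<in> Hom K' K" "k \<cdot> v = k'"
    using kernelD(2)[OF assms(4,5,2), of k' K'] by (auto simp: Hom_iff)
  note [simp] = v(1)[unfolded Hom_iff]
  have ek: "e \<cdot> k = Zero K P" by (rule kernelD(1)[OF assms(4,5,2)])
  have "k' \<cdot> (u \<cdot> k) = k" using biprod_split_in[OF b, of k] by (simp add: ek)
  then have "k \<cdot> (v \<cdot> (u \<cdot> k)) = k \<cdot> Id K" using cmp_reduce[OF v(2), of "u \<cdot> k"] by simp
  then have "v \<cdot> (u \<cdot> k) = Id K"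
    by (rule monicD[OF kernel_monic[OF assms(4)] assms(5), rotated -1]) (simp_all add: Hom_iff)
  moreover have "(u \<cdot> k) \<cdot> v = Id K'" by (simp add: assoc v(2))
  ultimately have "isomorphic_obj C K' K"
    unfolding isomorphic_obj_def by (intro bexI[of _ v] bexI[of _ "u \<cdot> k"]) (simp_all add: Hom_iff)
  then obtain f g where fg: "f \<in> Hom K' K" "g \<in> Hom K K'" "g \<cdot> f = Id K'" "f \<cdot> g = Id K"
    unfolding isomorphic_obj_def by blast
  note [simp] = fg(1,2)[unfolded Hom_iff] fg(3,4)
  have "(k' \<cdot> g) \<cdot> (f \<cdot> u) = k' \<cdot> u" using cmp_reduce[OF fg(3), of u] by (simp add: assoc)
  then have "biprod C X P K s (k' \<cdot> g) e (f \<cdot> u)"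
    unfolding biprod_def by (simp add: Hom_iff assoc)
  then show ?thesis unfolding direct_sum_pair by blast
qed

lemma is_syzygyI:
  "\<lbrakk>P \<in> projectives C; p \<in> Hom P M; i \<in> Hom N P; epic C p; is_kernel C i p\<rbrakk> \<Longrightarrow> is_syzygy C M N"
  unfolding is_syzygy_def by blast

lemma syzygy_obj: "is_syzygy C M N \<Longrightarrow> M \<in> obj C \<and> N \<in> obj C"
  unfolding is_syzygy_def using Hom_obj by blast

lemma ex_syzygy:
  assumes "enough_projectives C" "M \<in> obj C" shows "\<exists>N. is_syzygy C M N"
proof -
  obtain P p where p: "P \<in> projectives C" "p \<in> Hom P M" "epic C p"
    using assms unfolding enough_projectives_def by blast
  obtain k where "is_kernel C k p" using p ex_kernel by (auto simp: Hom_iff)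
  moreover from this have "k \<in> Hom (src C k) P" using p by (simp add: is_kernel_def Hom_iff)
  ultimately show ?thesis using is_syzygyI p by blast
qed

text \<open>Schanuel's lemma: both kernels are kernels of the projections of one pullback, which split.\<close>

lemma schanuel:
  assumes "is_syzygy C M N" "is_syzygy C M N'"
  shows "\<exists>E P P'. P \<in> projectives C \<and> P' \<in> projectives C \<and>
    direct_sum C E [P, N'] \<and> direct_sum C E [P', N]"
proof -
  obtain P p i where p: "P \<in> projectives C" "p \<in> Hom P M" "i \<in> Hom N P" "epic C p" "is_kernel C i p"
    using assms(1) unfolding is_syzygy_def by blast
  obtain P' p' i' where p': "P' \<in> projectives C" "p' \<in> Hom P' M" "i' \<in> Hom N' P'" "epic C p'"
    "is_kernel C i' p'" using assms(2) unfolding is_syzygy_def by blast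
  show ?thesis
    using pullback[OF p(2,4) p'(2,4) p(5,3) p'(5,3)] projective_quotient_splits p(1) p'(1) by blast
qed

text \<open>
  In an exact sequence \<open>0 \<rightarrow> P \<rightarrow> X \<rightarrow> S \<rightarrow> 0\<close> with \<open>P\<close> projective, pulling \<open>X \<rightarrow> S\<close> back along an
  epimorphism from a projective object onto \<open>S\<close> gives a split extension of projective objects,
  which maps onto \<open>X\<close> with kernel the syzygy of \<open>S\<close>.
\<close>

lemma syzygy_of_projective_extension:
  assumes "P \<in> projectives C" "e \<in> Hom X S" "epic C e" "is_kernel C k e" "k \<in> Hom P X"
    and "is_syzygy C S N"
  shows "is_syzygy C X N"
proof -
  obtain Q q i where q: "Q \<in> projectives C" "q \<in> Hom Q S" "i \<in> Hom N Q" "epic C q" "is_kernel C i q"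
    using assms(6) unfolding is_syzygy_def by blast
  obtain E a l' b k' where E: "a \<in> Hom E X" "epic C a" "l' \<in> Hom N E" "is_kernel C l' a"
    "b \<in> Hom E Q" "epic C b" "k' \<in> Hom P E" "is_kernel C k' b"
    using pullback[OF assms(2,3) q(2,4) assms(4,5) q(5,3)] by blast
  have "direct_sum C E [Q, P]" by (rule projective_quotient_splits[OF q(1) E(5,6,8,7)])
  then have "E \<in> projectives C" by (rule direct_sum_projective[OF _ q(1) assms(1)])
  then show ?thesis by (rule is_syzygyI[OF _ E(1,3,2,4)])
qed

text \<open>The defining sequence splits, so \<open>N\<close> is a summand of a projective object.\<close>

lemma syzygy_of_projective:
  assumes "M \<in> projectives C" "is_syzygy C M N" shows "N \<in> projectives C"
proof -
  obtain P p i where p: "P \<in> projectives C" "p \<in> Hom P M" "i \<in> Hom N P" "epic C p" "is_kernel C i p"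
    using assms(2) unfolding is_syzygy_def by blast
  have "direct_sum C P [M, N]" by (rule projective_quotient_splits[OF assms(1) p(2,4,5,3)])
  then show ?thesis using direct_sum_retracts retract_projective p(1) by blast
qed

text \<open>
  Every projective object is a syzygy of zero, so an object with a projective syzygy has a common
  syzygy with zero.
\<close>

lemma syzygy_of_zero:
  assumes "zero_obj C Z" "Q \<in> projectives C" shows "is_syzygy C Z Q"
proof (rule is_syzygyI[OF assms(2), of "Zero Q Z" Z "Id Q"])
  have Z: "Z \<in> obj C" "Id Z = Zero Z Z" using assms(1) by (simp_all add: zero_obj_iff)
  have [simp]: "Q \<in> obj C" "Z \<in> obj C" using projective_obj[OF assms(2)] Z(1) by simp_all
  show p: "Zero Q Z \<in> Hom Q Z" and i: "Id Q \<in> Hom Q Q" by (simp_all add: Hom_iff)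
  show "epic C (Zero Q Z)"
  proof (rule epicI[OF p])
    fix T t assume t: "t \<in> Hom Z T"
    have "t \<cdot> Zero Z Z = Zero Z T" using t Hom_obj[OF t] by (simp add: Hom_iff)
    then show "t = Zero Z T" using ident_right[OF t] Z(2) by simp
  qed
  show "is_kernel C (Id Q) (Zero Q Z)"
  proof (rule kernelI[OF i p])
    show "Zero Q Z \<cdot> Id Q = Zero Q Z" by simp
    show "monic C (Id Q)" using ident_left by (intro monicI[OF i]) simp
    show "\<exists>u\<in>Hom T Q. Id Q \<cdot> u = g" if "g \<in> Hom T Q" for T g using that ident_left by blast
  qed
qed

lemma syzygy_isomorphic:
  assumes "isomorphic_obj C M M'" "is_syzygy C M N" shows "is_syzygy C M' N"
proof -
  obtain P p i where p: "P \<in> projectives C" "p \<in> Hom P M" "i \<in> Hom N P" "epic C p" "is_kernel C i p"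
    using assms(2) unfolding is_syzygy_def by blast
  obtain f g where fg: "f \<in> Hom M M'" "g \<in> Hom M' M" "g \<cdot> f = Id M" "f \<cdot> g = Id M'"
    using assms unfolding isomorphic_obj_def by blast
  note [simp] = p(2,3)[unfolded Hom_iff] fg(1,2)[unfolded Hom_iff] fg(3,4)
  have [simp]: "M \<in> obj C" "M' \<in> obj C" "N \<in> obj C" "P \<in> obj C" using Hom_obj p fg by blast+
  have pi: "p \<cdot> i = Zero N M" by (rule kernelD(1)[OF p(5,3,2)])
  have "epic C (f \<cdot> p)"
  proof (rule epicI)
    fix T t assume t: "t \<in> Hom M' T" "t \<cdot> (f \<cdot> p) = Zero P T"
    note [simp] = t(1)[unfolded Hom_iff]
    have [simp]: "T \<in> obj C" using Hom_obj[OF t(1)] by simp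
    have "t \<cdot> f = Zero M T" using t(2) by (intro epic_zeroD[OF p(4,2)]) (simp_all add: Hom_iff assoc)
    then have "(t \<cdot> f) \<cdot> g = Zero M' T" by simp
    then show "t = Zero M' T" by (simp add: assoc)
  qed (simp add: Hom_iff)
  moreover have "is_kernel C i (f \<cdot> p)"
  proof (rule kernelI[OF p(3)])
    show "f \<cdot> p \<in> Hom P M'" "(f \<cdot> p) \<cdot> i = Zero N M'" by (simp_all add: Hom_iff assoc pi)
    show "monic C i" by (rule kernel_monic[OF p(5)])
    fix T x assume x: "x \<in> Hom T P" "(f \<cdot> p) \<cdot> x = Zero T M'"
    note [simp] = x(1)[unfolded Hom_iff]
    have [simp]: "T \<in> obj C" using Hom_obj[OF x(1)] by simp
    have "p \<cdot> x = g \<cdot> ((f \<cdot> p) \<cdot> x)" using cmp_reduce[OF fg(3), of "p \<cdot> x"] by (simp add: assoc)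
    also have "\<dots> = Zero T M" unfolding x(2) by simp
    finally show "\<exists>u\<in>Hom T N. i \<cdot> u = x" by (rule kernelD(2)[OF p(5,3,2) x(1)])
  qed
  moreover have "f \<cdot> p \<in> Hom P M'" by (simp add: Hom_iff)
  ultimately show ?thesis using is_syzygyI[OF p(1) _ p(3)] by blast
qed

lemma syzygy_direct_sum:
  assumes "direct_sum C M [S, T]" "is_syzygy C S N1" "is_syzygy C T N2" "direct_sum C N [N1, N2]"
  shows "is_syzygy C M N"
proof -
  obtain P1 p1 i1 where p1: "P1 \<in> projectives C" "p1 \<in> Hom P1 S" "i1 \<in> Hom N1 P1" "epic C p1"
    "is_kernel C i1 p1" using assms(2) unfolding is_syzygy_def by blast
  obtain P2 p2 i2 where p2: "P2 \<in> projectives C" "p2 \<in> Hom P2 T" "i2 \<in> Hom N2 P2" "epic C p2"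
    "is_kernel C i2 p2" using assms(3) unfolding is_syzygy_def by blast
  obtain P where P: "direct_sum C P [P1, P2]" using ex_direct_sum projective_obj p1(1) p2(1) by blast
  obtain a b c d where m: "biprod C M S T a b c d" using assms(1) direct_sum_pair by blast
  obtain a' b' c' d' where m': "biprod C P P1 P2 a' b' c' d'" using P direct_sum_pair by blast
  obtain a'' b'' c'' d'' where m'': "biprod C N N1 N2 a'' b'' c'' d''"
    using assms(4) direct_sum_pair by blast
  note [simp] = biprodD[OF m] biprodD[OF m'] biprodD[OF m''] p1(2,3)[unfolded Hom_iff]
    p2(2,3)[unfolded Hom_iff]
  have z [simp]: "p1 \<cdot> i1 = Zero N1 S" "p2 \<cdot> i2 = Zero N2 T"
    by (rule kernelD(1)[OF p1(5,3,2)], rule kernelD(1)[OF p2(5,3,2)])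
  have [simp]: "p1 \<cdot> (i1 \<cdot> x) = Zero (src C x) S" if "x \<in> arr C" "tgt C x = N1" for x
    using cmp_reduce[OF z(1), of x] that by simp
  have [simp]: "p2 \<cdot> (i2 \<cdot> x) = Zero (src C x) T" if "x \<in> arr C" "tgt C x = N2" for x
    using cmp_reduce[OF z(2), of x] that by simp
  let ?p = "a \<cdot> (p1 \<cdot> c') \<boxplus> b \<cdot> (p2 \<cdot> d')" and ?i = "a' \<cdot> (i1 \<cdot> c'') \<boxplus> b' \<cdot> (i2 \<cdot> d'')"
  have hp: "?p \<in> Hom P M" and hi: "?i \<in> Hom N P" by (simp_all add: Hom_iff)
  have "epic C ?p"
  proof (rule epicI[OF hp])
    fix U t assume t: "t \<in> Hom M U" "t \<cdot> ?p = Zero P U"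
    note [simp] = t(1)[unfolded Hom_iff]
    have [simp]: "U \<in> obj C" using Hom_obj[OF t(1)] by simp
    have "(t \<cdot> ?p) \<cdot> a' = Zero P1 U" "(t \<cdot> ?p) \<cdot> b' = Zero P2 U" unfolding t(2) by simp_all
    then have "(t \<cdot> a) \<cdot> p1 = Zero P1 U" "(t \<cdot> b) \<cdot> p2 = Zero P2 U"
      by (simp_all add: distrib assoc)
    then have "t \<cdot> a = Zero S U" "t \<cdot> b = Zero T U"
      by (intro epic_zeroD[OF p1(4,2)] epic_zeroD[OF p2(4,2)], simp_all add: Hom_iff)+
    then show "t = Zero M U" by (intro biprod_ext_out[OF m, of t]) simp_all
  qed
  moreover have "is_kernel C ?i ?p"
  proof (rule kernelI[OF hi hp])
    show "?p \<cdot> ?i = Zero N M" by (simp add: distrib assoc)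
    show "monic C ?i"
    proof (rule monicI[OF hi])
      fix U t assume t: "t \<in> Hom U N" "?i \<cdot> t = Zero U P"
      note [simp] = t(1)[unfolded Hom_iff]
      have [simp]: "U \<in> obj C" using Hom_obj[OF t(1)] by simp
      have "c' \<cdot> (?i \<cdot> t) = Zero U P1" "d' \<cdot> (?i \<cdot> t) = Zero U P2" unfolding t(2) by simp_all
      then have "i1 \<cdot> (c'' \<cdot> t) = Zero U P1" "i2 \<cdot> (d'' \<cdot> t) = Zero U P2"
        by (simp_all add: distrib assoc)
      then have "c'' \<cdot> t = Zero U N1" "d'' \<cdot> t = Zero U N2"
        by (intro monic_zeroD[OF kernel_monic[OF p1(5)] p1(3)]
            monic_zeroD[OF kernel_monic[OF p2(5)] p2(3)], simp_all add: Hom_iff)+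
      then show "t = Zero U N" by (intro biprod_ext_in[OF m'', of t]) simp_all
    qed
    fix U x assume x: "x \<in> Hom U P" "?p \<cdot> x = Zero U M"
    note [simp] = x(1)[unfolded Hom_iff]
    have [simp]: "U \<in> obj C" using Hom_obj[OF x(1)] by simp
    have "c \<cdot> (?p \<cdot> x) = Zero U S" "d \<cdot> (?p \<cdot> x) = Zero U T" unfolding x(2) by simp_all
    then have "p1 \<cdot> (c' \<cdot> x) = Zero U S" "p2 \<cdot> (d' \<cdot> x) = Zero U T"
      by (simp_all add: distrib assoc)
    then obtain y1 y2 where y: "y1 \<in> Hom U N1" "i1 \<cdot> y1 = c' \<cdot> x" "y2 \<in> Hom U N2" "i2 \<cdot> y2 = d' \<cdot> x"
      using kernelD(2)[OF p1(5,3,2), of "c' \<cdot> x" U] kernelD(2)[OF p2(5,3,2), of "d' \<cdot> x" U]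
      by (auto simp: Hom_iff)
    note [simp] = y(1,3)[unfolded Hom_iff]
    have "?i \<cdot> (a'' \<cdot> y1 \<boxplus> b'' \<cdot> y2) = x"
      by (rule biprod_ext_in[OF m']) (simp_all add: distrib assoc y(2,4))
    then show "\<exists>u\<in>Hom U N. ?i \<cdot> u = x"
      by (intro bexI[of _ "a'' \<cdot> y1 \<boxplus> b'' \<cdot> y2"]) (simp_all add: Hom_iff)
  qed
  ultimately show ?thesis
    using is_syzygyI[OF direct_sum_projective[OF P p1(1) p2(1)] hp hi] by blast
qed

end


section \<open>Krull-Schmidt multiplicities\<close>

text \<open>
  One of two endomorphisms with sum \<open>1\<close> is invertible. This is the consequence of a local
  endomorphism ring that exchange arguments use, and it is visibly self-dual, so that it passes to
  the opposite category without a discussion of opposite rings.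
\<close>

definition local_obj :: "('o, 'm) preadd_cat \<Rightarrow> 'o \<Rightarrow> bool" where
  "local_obj C X \<longleftrightarrow> X \<in> obj C \<and> ident C X \<noteq> mzero C X X \<and>
     (\<forall>f\<in>hom_set C X X. \<forall>g\<in>hom_set C X X.
        madd C f g = ident C X \<longrightarrow> iso_arr C f \<or> iso_arr C g)"

text \<open>
  The number of summands isomorphic to \<open>L\<close> in a decomposition of an object into local objects. It
  is a relation, because its independence of the decomposition is the Krull-Schmidt theorem.
\<close>

inductive ks_mult :: "('o, 'm) preadd_cat \<Rightarrow> 'o \<Rightarrow> 'o \<Rightarrow> nat \<Rightarrow> bool" for C L where
  zero: "zero_obj C Z \<Longrightarrow> ks_mult C L Z 0"
| sum: "\<lbrakk>direct_sum C X [Y, K]; local_obj C Y; ks_mult C L K n\<rbrakk>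
    \<Longrightarrow> ks_mult C L X ((if isomorphic_obj C Y L then 1 else 0) + n)"

context preadditive_category
begin

lemma local_ring_imp_local_obj:
  assumes X: "X \<in> obj C" and loc: "local_ring (End_ring C X)"
  shows "local_obj C X"
proof -
  let ?R = "End_ring C X"
  interpret R: ring ?R using loc by (simp add: local_ring_def)
  have R [simp]: "carrier ?R = Hom X X" "monoid.mult ?R = cmp C" "one ?R = Id X"
    "zero ?R = Zero X X" "add ?R = madd C" by (simp_all add: End_ring_def)
  have nz: "Id X \<noteq> Zero X X" using loc by (simp add: local_ring_def)
  have unit: "iso_arr C f" if "f \<in> Units ?R" for f
    using that unfolding Units_def iso_arr_def by (auto simp: Hom_iff)
  have "iso_arr C f \<or> iso_arr C g" if "f \<in> Hom X X" "g \<in> Hom X X" "f \<boxplus> g = Id X" for f g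
  proof -
    have "f \<boxplus> g \<in> Units ?R" using that R.Units_one_closed by simp
    moreover have "\<forall>x\<in>Hom X X - Units ?R. \<forall>y\<in>Hom X X - Units ?R. x \<boxplus> y \<notin> Units ?R"
      using loc unfolding local_ring_def R by blast
    ultimately have "f \<in> Units ?R \<or> g \<in> Units ?R" using that by blast
    then show ?thesis using unit by blast
  qed
  then show ?thesis unfolding local_obj_def using X nz by blast
qed

lemma iso_arrD:
  assumes "iso_arr C f" "f \<in> Hom X Y"
  shows "\<exists>g\<in>Hom Y X. g \<cdot> f = Id X \<and> f \<cdot> g = Id Y"
  using assms unfolding iso_arr_def by (auto simp: Hom_iff)

lemma iso_arrI:
  assumes "f \<in> Hom X Y" "g \<in> Hom Y X" "g \<cdot> f = Id X" "f \<cdot> g = Id Y"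
  shows "iso_arr C f"
  using assms unfolding iso_arr_def by (auto simp: Hom_iff)

lemma local_obj_not_zero: "local_obj C X \<Longrightarrow> \<not> zero_obj C X"
  by (simp add: local_obj_def zero_obj_iff)

lemma retract_of_local:
  assumes X: "local_obj C X" and Y: "\<not> zero_obj C Y"
    and s: "s \<in> Hom Y X" and r: "r \<in> Hom X Y" and rs: "r \<cdot> s = Id Y"
  shows "s \<cdot> r = Id X"
proof -
  note [simp] = s[unfolded Hom_iff] r[unfolded Hom_iff] rs
  have [simp]: "X \<in> obj C" "Y \<in> obj C" using Hom_obj[OF s] by auto
  have rsx [simp]: "r \<cdot> (s \<cdot> x) = x" if "x \<in> arr C" "tgt C x = Y" for x
    using that cmp_reduce[OF rs, of x] by simp
  \<comment> \<open>Of the complementary idempotents \<open>e\<close> and \<open>1 - e\<close> one is invertible, hence the identity.\<close>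
  let ?e = "s \<cdot> r" and ?e' = "Id X \<boxplus> Neg (s \<cdot> r)"
  have "?e \<boxplus> ?e' = Id X"
    by (subst add_left_commute) simp_all
  moreover have "?e \<in> Hom X X" "?e' \<in> Hom X X" by (simp_all add: Hom_iff)
  ultimately consider "iso_arr C ?e" | "iso_arr C ?e'" using X unfolding local_obj_def by blast
  then show ?thesis
  proof cases
    case 1
    then obtain g where g: "g \<in> Hom X X" "g \<cdot> ?e = Id X"
      using iso_arrD \<open>?e \<in> Hom X X\<close> by blast
    note [simp] = g(1)[unfolded Hom_iff]
    have "?e = (g \<cdot> ?e) \<cdot> ?e" unfolding g(2) by simp
    also have "\<dots> = g \<cdot> ?e" by (simp add: assoc)
    finally show ?thesis using g(2) by simp
  next
    case 2
    then obtain g where g: "g \<in> Hom X X" "g \<cdot> ?e' = Id X"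
      using iso_arrD \<open>?e' \<in> Hom X X\<close> by blast
    note [simp] = g(1)[unfolded Hom_iff]
    have "s = (g \<cdot> ?e') \<cdot> s" unfolding g(2) by simp
    also have "\<dots> = Zero Y X" by (simp add: assoc distrib neg_cmp)
    finally have "r \<cdot> s = Zero Y Y" by simp
    then show ?thesis using Y rs by (simp add: zero_obj_iff)
  qed
qed

lemma ks_mult_isomorphic:
  assumes "ks_mult C L X n" "isomorphic_obj C X X'" shows "ks_mult C L X' n"
  using assms(1)
proof cases
  case zero
  then show ?thesis
    using assms(2) retract_zero isomorphic_retract isomorphic_sym ks_mult.zero by metis
next
  case (sum Y K m)
  then show ?thesis using direct_sum_isomorphic[OF _ assms(2)] ks_mult.sum[of C X' Y K L m] by simp
qed

lemma ks_mult_retract: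
  assumes "ks_mult C L X n" "0 < n" shows "retract C L X"
  using assms
proof (induction rule: ks_mult.induct)
  case (sum X Y K n)
  have YX: "retract C Y X" "retract C K X" using direct_sum_retracts[OF sum.hyps(1)] by auto
  show ?case
  proof (cases "isomorphic_obj C Y L")
    case True
    then have "retract C L Y" using isomorphic_retract isomorphic_sym by blast
    then show ?thesis using YX(1) retract_trans by blast
  next
    case False
    then show ?thesis using sum.IH sum.prems YX(2) retract_trans by simp
  qed
qed simp

end

context abelian_category
begin

text \<open>
  Exchange: the identity of a local summand \<open>Y\<close> of \<open>Z \<oplus> K'\<close> is the sum of an endomorphism through
  \<open>Z\<close> and one through \<open>K'\<close>, so one of them is invertible. In the first case \<open>Y\<close> is isomorphic to
  \<open>Z\<close>, and elimination identifies the complements; in the second \<open>Y\<close> splits off from \<open>K'\<close>.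
\<close>

lemma ks_mult_cancel:
  assumes "ks_mult C L X n" "direct_sum C X [Y, K]" "local_obj C Y"
  shows "\<exists>m. ks_mult C L K m \<and> n = (if isomorphic_obj C Y L then 1 else 0) + m"
  using assms
proof (induction arbitrary: Y K rule: ks_mult.induct)
  case (zero Z)
  then show ?case using direct_sum_retracts retract_zero local_obj_not_zero by blast
next
  case (sum X Z K' m)
  obtain i j p q where b: "biprod C X Y K i j p q" using sum.prems direct_sum_pair by blast
  obtain i' j' p' q' where b': "biprod C X Z K' i' j' p' q'" using sum.hyps direct_sum_pair by blast
  note [simp] = biprodD[OF b] biprodD[OF b']
  let ?f = "(p \<cdot> i') \<cdot> (p' \<cdot> i)" and ?g = "(p \<cdot> j') \<cdot> (q' \<cdot> i)"
  have "p \<cdot> (i' \<cdot> (p' \<cdot> i) \<boxplus> j' \<cdot> (q' \<cdot> i)) = Id Y"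
    by (subst biprod_split_in[OF b']) simp_all
  then have "?f \<boxplus> ?g = Id Y" by (simp add: distrib assoc)
  moreover have "?f \<in> Hom Y Y" "?g \<in> Hom Y Y" by (simp_all add: Hom_iff)
  ultimately consider "iso_arr C ?f" | "iso_arr C ?g"
    using sum.prems(2) unfolding local_obj_def by blast
  then show ?case
  proof cases
    case 1
    then obtain h where h: "h \<in> Hom Y Y" "h \<cdot> ?f = Id Y" using iso_arrD \<open>?f \<in> Hom Y Y\<close> by blast
    note [simp] = h(1)[unfolded Hom_iff]
    have s: "p' \<cdot> i \<in> Hom Y Z" and r: "h \<cdot> (p \<cdot> i') \<in> Hom Z Y" by (simp_all add: Hom_iff)
    have rs: "(h \<cdot> (p \<cdot> i')) \<cdot> (p' \<cdot> i) = Id Y" using h(2) by (simp add: assoc)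
    have sr: "(p' \<cdot> i) \<cdot> (h \<cdot> (p \<cdot> i')) = Id Z"
      by (rule retract_of_local[OF sum.hyps(2) _ s r rs]) (rule local_obj_not_zero[OF sum.prems(2)])
    have "isomorphic_obj C K K'"
      by (rule complements_isomorphic[OF b b' iso_arrI[OF s r rs sr]])
    then have "ks_mult C L K m" using ks_mult_isomorphic sum.hyps isomorphic_sym by blast
    moreover have "isomorphic_obj C Y Z" unfolding isomorphic_obj_def using s r rs sr by blast
    then have "isomorphic_obj C Y L \<longleftrightarrow> isomorphic_obj C Z L"
      using isomorphic_trans isomorphic_sym by blast
    ultimately show ?thesis by auto
  next
    case 2
    then obtain h where h: "h \<in> Hom Y Y" "h \<cdot> ?g = Id Y" using iso_arrD \<open>?g \<in> Hom Y Y\<close> by blast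
    note [simp] = h(1)[unfolded Hom_iff]
    let ?s = "q' \<cdot> i" and ?r = "h \<cdot> (p \<cdot> j')"
    have s: "?s \<in> Hom Y K'" and r: "?r \<in> Hom K' Y" by (simp_all add: Hom_iff)
    have rs: "?r \<cdot> ?s = Id Y" using h(2) by (simp add: assoc)
    obtain K'' k u where b'': "biprod C K' Y K'' ?s k ?r u" using retract_biprod[OF s r rs] by blast
    have "direct_sum C K' [Y, K'']" using b'' direct_sum_pair by blast
    then obtain m' where m': "ks_mult C L K'' m'" "m = (if isomorphic_obj C Y L then 1 else 0) + m'"
      using sum.IH sum.prems(2) by blast
    obtain W where W: "direct_sum C W [K'', Z]"
      using ex_direct_sum biprodD(2)[OF b'] biprodD(3)[OF b''] by blast
    then obtain l r' where w: "biprod C X Y W (j' \<cdot> ?s) l (?r \<cdot> q') r'"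
      using biprod_assoc[OF biprod_sym[OF b'] b''] by blast
    have "(?r \<cdot> q') \<cdot> i = Id Y" using rs by (simp add: assoc)
    then have "iso_arr C ((?r \<cdot> q') \<cdot> i)"
      by (intro iso_arrI[of _ Y Y "Id Y"]) (simp_all add: Hom_iff)
    then have "isomorphic_obj C W K"
      using complements_isomorphic[OF b w] isomorphic_sym by blast
    moreover have "ks_mult C L W ((if isomorphic_obj C Z L then 1 else 0) + m')"
      by (rule ks_mult.sum[OF direct_sum_sym[OF W] sum.hyps(2) m'(1)])
    ultimately have "ks_mult C L K ((if isomorphic_obj C Z L then 1 else 0) + m')"
      using ks_mult_isomorphic by blast
    then show ?thesis using m'(2) by auto
  qed
qed

lemma ks_mult_unique:
  assumes "ks_mult C L X n" "ks_mult C L X n'" shows "n = n'"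
  using assms
proof (induction arbitrary: n' rule: ks_mult.induct)
  case (zero Z)
  from zero.prems show ?case
  proof cases
    case (sum Y K m)
    then show ?thesis
      using zero.hyps direct_sum_retracts retract_zero local_obj_not_zero by blast
  qed simp
next
  case (sum X Y K n)
  then show ?case using ks_mult_cancel by blast
qed

lemma ks_mult_add:
  assumes "ks_mult C L A a" "direct_sum C X [A, B]" "ks_mult C L B b"
  shows "ks_mult C L X (a + b)"
  using assms
proof (induction arbitrary: X rule: ks_mult.induct)
  case (zero Z)
  then show ?case using direct_sum_zero_left ks_mult_isomorphic isomorphic_sym by fastforce
next
  case (sum A Y K n)
  obtain W where W: "direct_sum C W [K, B]"
    using ex_direct_sum direct_sum_obj[OF sum.hyps(1)] direct_sum_obj[OF sum.prems(1)] by blast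
  have "direct_sum C X [Y, W]" by (rule direct_sum_assoc[OF sum.prems(1) sum.hyps(1) W])
  then show ?case
    using ks_mult.sum[OF _ sum.hyps(2) sum.IH[OF W sum.prems(2)]] by (simp add: add.assoc)
qed

lemma ks_mult_local_retract:
  assumes "ks_mult C L X n" "local_obj C L" "retract C L X" shows "0 < n"
proof -
  obtain K where "direct_sum C X [L, K]" using retract_direct_sum assms(3) by blast
  then obtain m where "n = (if isomorphic_obj C L L then 1 else 0) + m"
    using ks_mult_cancel assms(1,2) by blast
  then show ?thesis using isomorphic_refl assms(2) by (simp add: local_obj_def)
qed

end

locale ks_category = abelian_category +
  assumes ex_decomposition:
    "X \<in> obj C \<Longrightarrow> \<exists>Ys. direct_sum C X Ys \<and> (\<forall>Y\<in>set Ys. local_obj C Y)"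
begin

lemma decomposition_induct [consumes 1, case_names zero sum]:
  assumes "X \<in> obj C" and "\<And>Z. zero_obj C Z \<Longrightarrow> P Z"
    and "\<And>X Y K. \<lbrakk>direct_sum C X [Y, K]; local_obj C Y; P K\<rbrakk> \<Longrightarrow> P X"
  shows "P X"
proof -
  have "P X" if "direct_sum C X Ys" "\<forall>Y\<in>set Ys. local_obj C Y" for Ys
    using that
  proof (induction Ys arbitrary: X)
    case Nil
    then show ?case using assms(2) direct_sum_Nil by blast
  next
    case (Cons Y Ys)
    then show ?case using direct_sum_Cons[of X Y Ys] assms(3) by (meson list.set_intros)
  qed
  then show ?thesis using ex_decomposition[OF assms(1)] by blast
qed

lemma ex_ks_mult: "X \<in> obj C \<Longrightarrow> \<exists>n. ks_mult C L X n"
  by (induction rule: decomposition_induct) (blast intro: ks_mult.intros)+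

lemma projective_if_local_retracts:
  assumes "X \<in> obj C" "\<And>L. \<lbrakk>local_obj C L; retract C L X\<rbrakk> \<Longrightarrow> L \<in> projectives C"
  shows "X \<in> projectives C"
  using assms
proof (induction rule: decomposition_induct)
  case (zero Z)
  then show ?case by (simp add: zero_projective)
next
  case (sum X Y K)
  have "Y \<in> projectives C" "K \<in> projectives C"
    using sum direct_sum_retracts[OF sum.hyps(1)] retract_trans by blast+
  then show ?case using direct_sum_projective sum.hyps(1) by blast
qed

end


section \<open>The group of stable classes and the syzygy endomorphism\<close>

lemma K_free_comm_group: "comm_group (K_free C)"
  by (simp add: K_free_def abelian_free_Abelian_group)

lemma K_free_simps [simp]:
  "x \<in> carrier (K_free C) \<longleftrightarrow> Poly_Mapping.keys x \<subseteq> iso_class C ` obj C"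
  "x \<otimes>\<^bsub>K_free C\<^esub> y = x + y" "one (K_free C) = 0"
  by (simp_all add: K_free_def)

context preadditive_category
begin

lemma K_relation_generators:
  "{frag_of (iso_class C N) - frag_of (iso_class C S) - frag_of (iso_class C T) |N S T.
         direct_sum C N [S, T]} \<union>
      {frag_of (iso_class C P) |P. P \<in> projectives C} \<subseteq> carrier (K_free C)"
proof -
  have "frag_of (iso_class C N) - frag_of (iso_class C S) - frag_of (iso_class C T) \<in> carrier (K_free C)"
    if "direct_sum C N [S, T]" for N S T
  proof -
    let ?G = "K_free C"
    interpret comm_group ?G by (rule K_free_comm_group)
    have c: "frag_of (iso_class C X) \<in> carrier ?G" if "X \<in> obj C" for X
      using that by (simp add: keys_frag_of)
    have m: "- frag_of (iso_class C X) \<in> carrier ?G" if "X \<in> obj C" for X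
      using that by (simp add: keys_frag_of)
    have "frag_of (iso_class C N) + - frag_of (iso_class C S) + - frag_of (iso_class C T) \<in> carrier ?G"
      using direct_sum_obj[OF that] m_closed[OF m_closed[OF c m] m] by (simp only: K_free_simps)
    then show ?thesis by (simp only: diff_conv_add_uminus)
  qed
  moreover have "frag_of (iso_class C P) \<in> carrier (K_free C)" if "P \<in> projectives C" for P
    using that by (simp add: keys_frag_of projectives_def)
  ultimately show ?thesis by blast
qed

lemma K_relations_subgroup: "subgroup (K_relations C) (K_free C)"
  unfolding K_relations_def
  using group.generate_is_subgroup[OF comm_group.axioms(2)[OF K_free_comm_group] K_relation_generators] .

lemma K_relations_normal: "K_relations C \<lhd> K_free C"
  using comm_group.normal_iff_subgroup[OF K_free_comm_group] K_relations_subgroup by blast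

lemma K_group_comm_group: "comm_group (K_group C)"
  unfolding K_group_def using comm_group.abelian_FactGroup[OF K_free_comm_group K_relations_subgroup] .

lemma K_class_closed [simp]: "M \<in> obj C \<Longrightarrow> K_class C M \<in> carrier (K_group C)"
  unfolding K_class_def K_group_def carrier_FactGroup by (rule imageI) (simp add: keys_frag_of)

lemma K_coset_add:
  assumes "x \<in> carrier (K_free C)" "y \<in> carrier (K_free C)"
  shows "(K_relations C #>\<^bsub>K_free C\<^esub> x) \<otimes>\<^bsub>K_group C\<^esub> (K_relations C #>\<^bsub>K_free C\<^esub> y)
    = K_relations C #>\<^bsub>K_free C\<^esub> (x + y)"
  using normal.rcos_sum[OF K_relations_normal assms] by (simp add: K_group_def)

lemma K_coset_eq:
  assumes "r \<in> K_relations C" "x \<in> carrier (K_free C)"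
  shows "K_relations C #>\<^bsub>K_free C\<^esub> (r + x) = K_relations C #>\<^bsub>K_free C\<^esub> x"
proof -
  interpret comm_group "K_free C" by (rule K_free_comm_group)
  have "r + x \<in> K_relations C #>\<^bsub>K_free C\<^esub> x" using assms by (auto simp: r_coset_def)
  then show ?thesis using repr_independence assms(2) K_relations_subgroup by metis
qed

lemma K_class_direct_sum:
  assumes "direct_sum C N [S, T]"
  shows "K_class C N = K_class C S \<otimes>\<^bsub>K_group C\<^esub> K_class C T"
proof -
  let ?r = "frag_of (iso_class C N) - frag_of (iso_class C S) - frag_of (iso_class C T)"
  interpret comm_group "K_free C" by (rule K_free_comm_group)
  have c: "frag_of (iso_class C X) \<in> carrier (K_free C)" if "X \<in> {N, S, T}" for X
    using that direct_sum_obj[OF assms] by (auto simp: keys_frag_of)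
  have st: "frag_of (iso_class C S) + frag_of (iso_class C T) \<in> carrier (K_free C)"
    using m_closed[OF c[of S] c[of T]] by simp
  have "?r \<in> K_relations C" unfolding K_relations_def using assms by (blast intro: generate.incl)
  from K_coset_eq[OF this st] show ?thesis
    using K_coset_add[OF c[of S] c[of T]] by (simp add: K_class_def)
qed

lemma K_class_projective:
  assumes "P \<in> projectives C" shows "K_class C P = one (K_group C)"
proof -
  interpret comm_group "K_free C" by (rule K_free_comm_group)
  have "frag_of (iso_class C P) \<in> K_relations C"
    unfolding K_relations_def using assms by (blast intro: generate.incl)
  then have "K_relations C #>\<^bsub>K_free C\<^esub> frag_of (iso_class C P) = K_relations C"
    using coset_join2[of "frag_of (iso_class C P)" "K_relations C"] K_relations_subgroup
      subgroup.mem_carrier[OF K_relations_subgroup] by blast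
  then show ?thesis by (simp add: K_class_def K_group_def)
qed

lemma K_group_universal:
  assumes H: "comm_group H"
    and closed: "\<And>M. M \<in> obj C \<Longrightarrow> f M \<in> carrier H"
    and iso: "\<And>M N. isomorphic_obj C M N \<Longrightarrow> f M = f N"
    and sum: "\<And>N S T. direct_sum C N [S, T] \<Longrightarrow> f N = f S \<otimes>\<^bsub>H\<^esub> f T"
    and proj: "\<And>P. P \<in> projectives C \<Longrightarrow> f P = one H"
  shows "\<exists>h\<in>hom (K_group C) H. \<forall>M\<in>obj C. h (K_class C M) = f M"
proof -
  interpret H: comm_group H by fact
  interpret F: comm_group "K_free C" by (rule K_free_comm_group)
  define F where "F c = f (SOME M. M \<in> c)" for c
  have F: "F (iso_class C M) = f M" if "M \<in> obj C" for M
  proof -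
    have "M \<in> iso_class C M" using that isomorphic_refl by (simp add: iso_class_def)
    then have "(SOME M'. M' \<in> iso_class C M) \<in> iso_class C M" by (rule someI)
    then show ?thesis unfolding F_def using iso by (auto simp: iso_class_def)
  qed
  have "F ` iso_class C ` obj C \<subseteq> carrier H" using F closed by auto
  then obtain h0 where h0: "h0 \<in> hom (K_free C) H"
    "\<And>x. x \<in> iso_class C ` obj C \<Longrightarrow> h0 (frag_of x) = F x"
    using H.free_Abelian_group_universal unfolding K_free_def by blast
  interpret h0: group_hom "K_free C" H h0
    by (simp add: group_hom_def group_hom_axioms_def h0)
  have h0f: "h0 (frag_of (iso_class C M)) = f M" if "M \<in> obj C" for M
    using that h0(2) F by simp
  have "h0 (frag_of (iso_class C N) - frag_of (iso_class C S) - frag_of (iso_class C T)) = one H"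
    if "direct_sum C N [S, T]" for N S T
  proof -
    let ?r = "frag_of (iso_class C N) - frag_of (iso_class C S) - frag_of (iso_class C T)"
    have r: "?r \<in> carrier (K_free C)" using K_relation_generators that by blast
    note o = direct_sum_obj[OF that]
    have c: "frag_of (iso_class C X) \<in> carrier (K_free C)" if "X \<in> {N, S, T}" for X
      using that o by (auto simp: keys_frag_of)
    have "f N = h0 (?r \<otimes>\<^bsub>K_free C\<^esub> (frag_of (iso_class C S) \<otimes>\<^bsub>K_free C\<^esub> frag_of (iso_class C T)))"
      using h0f o by simp
    also have "\<dots> = h0 ?r \<otimes>\<^bsub>H\<^esub> (f S \<otimes>\<^bsub>H\<^esub> f T)"
      using r c o F.m_closed[OF c[of S] c[of T]] h0f
      by (simp only: h0.hom_mult insert_iff simp_thms)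
    finally have "f N = h0 ?r \<otimes>\<^bsub>H\<^esub> f N" using sum[OF that] by simp
    then show ?thesis using H.r_cancel_one'[of "f N" "h0 ?r"] closed o h0.hom_closed[OF r] by simp
  qed
  moreover have "h0 (frag_of (iso_class C P)) = one H" if "P \<in> projectives C" for P
    using h0f projective_obj that proj by simp
  ultimately have "x \<in> kernel (K_free C) H h0"
    if "x \<in> {frag_of (iso_class C N) - frag_of (iso_class C S) - frag_of (iso_class C T) |N S T.
         direct_sum C N [S, T]} \<union> {frag_of (iso_class C P) |P. P \<in> projectives C}" for x
    unfolding kernel_def using that K_relation_generators by blast
  then have "K_relations C \<subseteq> kernel (K_free C) H h0"
    unfolding K_relations_def by (intro F.generate_subgroup_incl h0.subgroup_kernel subsetI)
  then obtain g where g: "g \<in> hom (K_free C Mod K_relations C) H"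
    "\<And>x. x \<in> carrier (K_free C) \<Longrightarrow> g (K_relations C #>\<^bsub>K_free C\<^esub> x) = h0 x"
    using h0.FactGroup_universal_kernel[OF K_relations_normal] by blast
  show ?thesis
  proof (intro bexI ballI)
    show "g \<in> hom (K_group C) H" using g(1) by (simp add: K_group_def)
    show "g (K_class C M) = f M" if "M \<in> obj C" for M
      using that g(2)[of "frag_of (iso_class C M)"] h0f by (simp add: K_class_def keys_frag_of)
  qed
qed

text \<open>The classes of objects generate the group.\<close>

lemma K_group_hom_eq:
  assumes h: "h \<in> hom (K_group C) H" and h': "h' \<in> hom (K_group C) H" and H: "group H"
    and eq: "\<And>M. M \<in> obj C \<Longrightarrow> h (K_class C M) = h' (K_class C M)"
    and x: "x \<in> carrier (K_group C)"
  shows "h x = h' x"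
proof -
  interpret H: group H by fact
  interpret K: comm_group "K_group C" by (rule K_group_comm_group)
  interpret h: group_hom "K_group C" H h by (simp add: group_hom_def group_hom_axioms_def h)
  interpret h': group_hom "K_group C" H h' by (simp add: group_hom_def group_hom_axioms_def h')
  let ?q = "\<lambda>x. K_relations C #>\<^bsub>K_free C\<^esub> x"
  have q: "?q y \<in> carrier (K_group C)" if "y \<in> carrier (K_free C)" for y
    unfolding K_group_def carrier_FactGroup using that by blast
  have main: "h (?q y) = h' (?q y)" if "Poly_Mapping.keys y \<subseteq> iso_class C ` obj C" for y
  proof (rule free_Abelian_group_induct[OF that])
    have "?q 0 \<otimes>\<^bsub>K_group C\<^esub> ?q 0 = ?q 0" using K_coset_add[of 0 0] by simp
    then have "?q 0 = one (K_group C)" using K.r_cancel_one[of "?q 0" "?q 0"] q[of 0] by simp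
    then show "h (?q 0) = h' (?q 0)" by simp
  next
    fix y z :: "'o set \<Rightarrow>\<^sub>0 int"
    assume 2: "Poly_Mapping.keys y \<subseteq> iso_class C ` obj C" "Poly_Mapping.keys z \<subseteq> iso_class C ` obj C"
      "h (?q y) = h' (?q y)" "h (?q z) = h' (?q z)"
    have c: "y - z \<in> carrier (K_free C)"
      using 2 keys_diff[of y z] by auto
    have "?q (y - z) \<otimes>\<^bsub>K_group C\<^esub> ?q z = ?q y" using K_coset_add[OF c, of z] 2 by simp
    then have "h (?q (y - z)) \<otimes>\<^bsub>H\<^esub> h (?q z) = h (?q y)" "h' (?q (y - z)) \<otimes>\<^bsub>H\<^esub> h' (?q z) = h' (?q y)"
      using q[OF c] q[of z] 2(2) h.hom_mult[of "?q (y - z)" "?q z"] h'.hom_mult[of "?q (y - z)" "?q z"]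
      by (simp_all del: h.hom_mult h'.hom_mult)
    then show "h (?q (y - z)) = h' (?q (y - z))" using 2(3,4) q[OF c] q[of z] 2(2)
      by (metis H.right_cancel h.hom_closed h'.hom_closed K_free_simps(1))
  next
    fix a assume "a \<in> iso_class C ` obj C"
    then show "h (?q (frag_of a)) = h' (?q (frag_of a))" using eq by (auto simp: K_class_def)
  qed
  obtain y where "y \<in> carrier (K_free C)" "x = ?q y"
    using x unfolding K_group_def carrier_FactGroup by blast
  then show ?thesis using main by simp
qed

end

locale enough_projectives_category = abelian_category +
  assumes enough: "enough_projectives C"
begin

lemma syzygy_class_unique:
  assumes "is_syzygy C M N" "is_syzygy C M N'" shows "K_class C N = K_class C N'"
proof -
  interpret K: comm_group "K_group C" by (rule K_group_comm_group)
  obtain E P P' where "P \<in> projectives C" "P' \<in> projectives C"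
    "direct_sum C E [P, N']" "direct_sum C E [P', N]"
    using schanuel[OF assms] by blast
  then have "K_class C E = K_class C N'" "K_class C E = K_class C N"
    using assms[THEN syzygy_obj] K_class_direct_sum[of E P N'] K_class_direct_sum[of E P' N]
      K_class_projective by simp_all
  then show ?thesis by simp
qed

text \<open>
  The class of a syzygy of \<open>M\<close> is independent of choices, additive in \<open>M\<close> and trivial for projective
  \<open>M\<close>, so it induces an endomorphism by the universal property. Two such endomorphisms agree on the
  classes of objects, which generate the group.
\<close>

lemma Omega_characterization:
  "Omega C \<in> hom (K_group C) (K_group C) \<inter> extensional (carrier (K_group C)) \<and>
     (\<forall>M N. is_syzygy C M N \<longrightarrow> Omega C (K_class C M) = K_class C N)"
proof -
  interpret K: comm_group "K_group C" by (rule K_group_comm_group)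
  let ?K = "K_group C"
  define f where "f M = K_class C (SOME N. is_syzygy C M N)" for M
  have f: "f M = K_class C N" if "is_syzygy C M N" for M N
    unfolding f_def using syzygy_class_unique[OF someI[of "is_syzygy C M", OF that] that] .
  have "\<exists>h\<in>hom ?K ?K. \<forall>M\<in>obj C. h (K_class C M) = f M"
  proof (rule K_group_universal[of ?K f])
    show "comm_group ?K" by (rule K_group_comm_group)
    show "f M \<in> carrier ?K" if M: "M \<in> obj C" for M
    proof -
      obtain N where "is_syzygy C M N" using ex_syzygy[OF enough M] by blast
      then show ?thesis using f syzygy_obj by fastforce
    qed
    show "f M = f N" if "isomorphic_obj C M N" for M N
      using that ex_syzygy[OF enough] isomorphic_obj_obj[OF that] f syzygy_isomorphic by metis
    show "f P = one ?K" if P: "P \<in> projectives C" for P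
    proof -
      obtain N where N: "is_syzygy C P N" using ex_syzygy[OF enough projective_obj[OF P]] by blast
      show ?thesis using f[OF N] K_class_projective[OF syzygy_of_projective[OF P N]] by simp
    qed
    show "f N = f S \<otimes>\<^bsub>?K\<^esub> f T" if d: "direct_sum C N [S, T]" for N S T
    proof -
      obtain A B where A: "is_syzygy C S A" and B: "is_syzygy C T B"
        using ex_syzygy[OF enough] direct_sum_obj[OF d] by blast
      obtain D where D: "direct_sum C D [A, B]"
        using ex_direct_sum syzygy_obj[OF A] syzygy_obj[OF B] by blast
      show ?thesis
        using f[OF A] f[OF B] f[OF syzygy_direct_sum[OF d A B D]] K_class_direct_sum[OF D] by simp
    qed
  qed
  then obtain h where h: "h \<in> hom ?K ?K" "\<And>M. M \<in> obj C \<Longrightarrow> h (K_class C M) = f M" by blast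
  let ?h = "restrict h (carrier ?K)"
  have "\<exists>!\<omega>. \<omega> \<in> hom ?K ?K \<inter> extensional (carrier ?K) \<and>
     (\<forall>M N. is_syzygy C M N \<longrightarrow> \<omega> (K_class C M) = K_class C N)"
  proof (rule ex1I[of _ ?h])
    have "?h \<in> hom ?K ?K" using h(1) by (auto simp: hom_def Pi_iff)
    moreover have "?h (K_class C M) = K_class C N" if "is_syzygy C M N" for M N
      using h(2) f[OF that] syzygy_obj[OF that] by simp
    ultimately show 1: "?h \<in> hom ?K ?K \<inter> extensional (carrier ?K) \<and>
     (\<forall>M N. is_syzygy C M N \<longrightarrow> ?h (K_class C M) = K_class C N)" by simp
    fix \<omega> assume \<omega>: "\<omega> \<in> hom ?K ?K \<inter> extensional (carrier ?K) \<and>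
     (\<forall>M N. is_syzygy C M N \<longrightarrow> \<omega> (K_class C M) = K_class C N)"
    show "\<omega> = ?h"
    proof (rule extensionalityI[of _ "carrier ?K"])
      fix x assume x: "x \<in> carrier ?K"
      show "\<omega> x = ?h x"
      proof (rule K_group_hom_eq[OF _ _ _ _ x])
        show "\<omega> \<in> hom ?K ?K" using \<omega> by blast
        show "?h \<in> hom ?K ?K" using 1 by blast
        show "group ?K" by (rule K.is_group)
        fix M assume "M \<in> obj C"
        then obtain N where "is_syzygy C M N" using ex_syzygy[OF enough] by blast
        then show "\<omega> (K_class C M) = ?h (K_class C M)" using 1 \<omega> by metis
      qed
    qed (use 1 \<omega> in auto)
  qed
  then show ?thesis unfolding Omega_def by (rule theI')
qed

lemma Omega_hom: "Omega C \<in> hom (K_group C) (K_group C)"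
  and Omega_syzygy: "is_syzygy C M N \<Longrightarrow> Omega C (K_class C M) = K_class C N"
  using Omega_characterization by auto

end

text \<open>
  The multiplicity of a nonprojective local object is additive, and it vanishes on projective
  objects because their summands are projective. So it defines a homomorphism from the group of
  stable classes to the integers.
\<close>

lemma (in ks_category) ks_mult_eq_of_K_class_eq:
  assumes "local_obj C L" "L \<notin> projectives C"
    and "ks_mult C L X m" "ks_mult C L Y n" "X \<in> obj C" "Y \<in> obj C" "K_class C X = K_class C Y"
  shows "m = n"
proof -
  define f where "f X = int (THE n. ks_mult C L X n)" for X
  have f: "f X = int n" if "ks_mult C L X n" for X n
    unfolding f_def using that ks_mult_unique by (metis (mono_tags, lifting) the_equality)
  have "\<exists>h\<in>hom (K_group C) integer_group. \<forall>M\<in>obj C. h (K_class C M) = f M"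
  proof (rule K_group_universal[of integer_group f])
    show "comm_group integer_group" by (rule abelian_integer_group)
    show "f M = f N" if "isomorphic_obj C M N" for M N
      using ex_ks_mult isomorphic_obj_obj[OF that] f ks_mult_isomorphic that by metis
    show "f N = f S \<otimes>\<^bsub>integer_group\<^esub> f T" if d: "direct_sum C N [S, T]" for N S T
    proof -
      obtain a b where ab: "ks_mult C L S a" "ks_mult C L T b"
        using ex_ks_mult direct_sum_obj[OF d] by blast
      show ?thesis using f[OF ab(1)] f[OF ab(2)] f[OF ks_mult_add[OF ab(1) d ab(2)]] by simp
    qed
    show "f P = one integer_group" if P: "P \<in> projectives C" for P
    proof -
      obtain a where a: "ks_mult C L P a" using ex_ks_mult projective_obj[OF P] by blast
      then have "a = 0" using ks_mult_retract assms(2) retract_projective P by blast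
      then show ?thesis using f[OF a] by simp
    qed
  qed simp_all
  then have "f X = f Y" using assms by metis
  then show ?thesis using f assms by simp
qed


section \<open>Indecomposable objects of the stable category\<close>

text \<open>
  In a decomposition of \<open>X\<close> one of the two projectors is invertible. It annihilates the other
  summand, which is therefore zero.
\<close>

lemma (in preadditive_category) local_obj_indecomposable:
  assumes "local_obj C X" shows "indecomposable C X"
proof -
  have "zero_obj C Y \<or> zero_obj C Z" if "direct_sum C X [Y, Z]" for Y Z
  proof -
    obtain i j p q where b: "biprod C X Y Z i j p q" using \<open>direct_sum C X [Y, Z]\<close> direct_sum_pair by blast
    note [simp] = biprodD[OF b]
    have "i \<cdot> p \<in> Hom X X" "j \<cdot> q \<in> Hom X X" by (simp_all add: Hom_iff)
    moreover from this have "iso_arr C (i \<cdot> p) \<or> iso_arr C (j \<cdot> q)"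
      using assms biprodD(20)[OF b] unfolding local_obj_def by blast
    ultimately consider g where "g \<in> Hom X X" "(i \<cdot> p) \<cdot> g = Id X" | g where "g \<in> Hom X X" "(j \<cdot> q) \<cdot> g = Id X"
      using iso_arrD by blast
    then show ?thesis
    proof cases
      case 1
      note [simp] = 1(1)[unfolded Hom_iff]
      have "Id Z = q \<cdot> (((i \<cdot> p) \<cdot> g) \<cdot> j)" unfolding 1(2) by simp
      also have "\<dots> = Zero Z Z" by (simp add: assoc)
      finally show ?thesis by (simp add: zero_obj_iff)
    next
      case 2
      note [simp] = 2(1)[unfolded Hom_iff]
      have "Id Y = p \<cdot> (((j \<cdot> q) \<cdot> g) \<cdot> i)" unfolding 2(2) by simp
      also have "\<dots> = Zero Y Y" by (simp add: assoc)
      finally show ?thesis by (simp add: zero_obj_iff)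
    qed
  qed
  then show ?thesis
    unfolding indecomposable_def using assms local_obj_not_zero by (auto simp: local_obj_def)
qed

context additive_category
begin

abbreviation PH where "PH \<equiv> proj_homs C"
abbreviation cls where "cls \<equiv> stable_class C"

lemma proj_homs_Hom: "PH X Y \<subseteq> Hom X Y"
  unfolding proj_homs_def using cmp_hom by blast

lemma proj_homs_cmp_left:
  assumes "f \<in> PH X Y" "t \<in> Hom Y Z" shows "t \<cdot> f \<in> PH X Z"
proof -
  obtain g h P where f: "f = h \<cdot> g" "P \<in> projectives C" "g \<in> Hom X P" "h \<in> Hom P Y"
    using assms(1) unfolding proj_homs_def by blast
  have "t \<cdot> f = (t \<cdot> h) \<cdot> g" unfolding f(1) using cmp_assoc[OF f(3,4) assms(2)] by simp
  then show ?thesis unfolding proj_homs_def using f(2,3) cmp_hom[OF f(4) assms(2)] by blast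
qed

lemma proj_homs_cmp_right:
  assumes "f \<in> PH Y Z" "t \<in> Hom X Y" shows "f \<cdot> t \<in> PH X Z"
proof -
  obtain g h P where f: "f = h \<cdot> g" "P \<in> projectives C" "g \<in> Hom Y P" "h \<in> Hom P Z"
    using assms(1) unfolding proj_homs_def by blast
  have "f \<cdot> t = h \<cdot> (g \<cdot> t)" unfolding f(1) using cmp_assoc[OF assms(2) f(3,4)] by simp
  then show ?thesis unfolding proj_homs_def using f(2,4) cmp_hom[OF assms(2) f(3)] by blast
qed

lemma proj_homs_zero:
  assumes "X \<in> obj C" "Y \<in> obj C" shows "Zero X Y \<in> PH X Y"
proof -
  obtain Q where Q: "Q \<in> projectives C" using ex_projective by blast
  have [simp]: "Q \<in> obj C" using Q projective_obj by blast
  have "Zero X Y = Zero Q Y \<cdot> Zero X Q" "Zero X Q \<in> Hom X Q" "Zero Q Y \<in> Hom Q Y"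
    using assms by (simp_all add: Hom_iff)
  then show ?thesis unfolding proj_homs_def using Q by blast
qed

lemma proj_homs_add:
  assumes "f \<in> PH X Y" "f' \<in> PH X Y" shows "f \<boxplus> f' \<in> PH X Y"
proof -
  obtain g h P where f: "f = h \<cdot> g" "P \<in> projectives C" "g \<in> Hom X P" "h \<in> Hom P Y"
    using assms(1) unfolding proj_homs_def by blast
  obtain g' h' P' where f': "f' = h' \<cdot> g'" "P' \<in> projectives C" "g' \<in> Hom X P'" "h' \<in> Hom P' Y"
    using assms(2) unfolding proj_homs_def by blast
  obtain S where S: "direct_sum C S [P, P']" using ex_direct_sum projective_obj f(2) f'(2) by blast
  then obtain i j p q where b: "biprod C S P P' i j p q" using direct_sum_pair by blast
  note [simp] = biprodD[OF b] f(3,4)[unfolded Hom_iff] f'(3,4)[unfolded Hom_iff]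
  have [simp]: "X \<in> obj C" "Y \<in> obj C" using Hom_obj[OF f(3)] Hom_obj[OF f(4)] by auto
  have "(h \<cdot> p \<boxplus> h' \<cdot> q) \<cdot> (i \<cdot> g \<boxplus> j \<cdot> g') = f \<boxplus> f'"
    unfolding f(1) f'(1) by (simp add: distrib assoc)
  moreover have "h \<cdot> p \<boxplus> h' \<cdot> q \<in> Hom S Y" "i \<cdot> g \<boxplus> j \<cdot> g' \<in> Hom X S" by (simp_all add: Hom_iff)
  ultimately have "\<exists>g h P. f \<boxplus> f' = h \<cdot> g \<and> P \<in> projectives C \<and> g \<in> Hom X P \<and> h \<in> Hom P Y"
    using direct_sum_projective[OF S f(2) f'(2)] by metis
  then show ?thesis unfolding proj_homs_def by blast
qed

lemma proj_homs_neg: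
  assumes "f \<in> PH X Y" shows "Neg f \<in> PH X Y"
proof -
  have f: "f \<in> Hom X Y" using assms proj_homs_Hom by blast
  note [simp] = f[unfolded Hom_iff]
  have [simp]: "Y \<in> obj C" using Hom_obj[OF f] by simp
  have "Neg f = Neg (Id Y) \<cdot> f" by (simp add: neg_cmp)
  then show ?thesis using proj_homs_cmp_left[OF assms, of "Neg (Id Y)" Y] by (simp add: Hom_iff)
qed

lemma proj_homs_subgroup:
  assumes "X \<in> obj C" "Y \<in> obj C" shows "subgroup (PH X Y) (hom_group C X Y)"
proof -
  interpret comm_group "hom_group C X Y" by (rule hom_comm_group[OF assms])
  show ?thesis
  proof (rule subgroupI)
    show "PH X Y \<noteq> {}" using proj_homs_zero[OF assms] by blast
    fix f assume f: "f \<in> PH X Y"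
    then have "f \<in> Hom X Y" using proj_homs_Hom by blast
    then have "src C f = X" "tgt C f = Y" by (simp_all add: Hom_iff)
    then show "inv\<^bsub>hom_group C X Y\<^esub> f \<in> PH X Y" using proj_homs_neg[OF f] by (simp add: mneg_def)
  qed (simp_all add: proj_homs_Hom proj_homs_add)
qed

lemma stable_class_coset: "f \<in> Hom X Y \<Longrightarrow> cls f = PH X Y #>\<^bsub>hom_group C X Y\<^esub> f"
  by (simp add: stable_class_def Hom_iff)

lemma stable_class_iff:
  assumes "f \<in> Hom X Y"
  shows "g \<in> cls f \<longleftrightarrow> (\<exists>h\<in>PH X Y. g = h \<boxplus> f)"
  using stable_class_coset[OF assms] by (auto simp: r_coset_def)

lemma stable_class_Hom:
  assumes "f \<in> Hom X Y" "g \<in> cls f" shows "g \<in> Hom X Y"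
proof -
  obtain h where "h \<in> PH X Y" "g = h \<boxplus> f" using stable_class_iff assms by blast
  moreover from this have "h \<in> Hom X Y" using proj_homs_Hom by blast
  ultimately show ?thesis using assms(1) by (simp add: Hom_iff)
qed

lemma stable_class_self:
  assumes "f \<in> Hom X Y" shows "f \<in> cls f"
  using stable_class_iff[OF assms] proj_homs_zero[of X Y] Hom_obj[OF assms] assms
  by (auto simp: Hom_iff intro!: bexI[of _ "Zero X Y"])

lemma stable_class_eqI:
  assumes "f \<in> Hom X Y" "g \<in> cls f" shows "cls g = cls f"
proof -
  interpret comm_group "hom_group C X Y" using Hom_obj[OF assms(1)] by (intro hom_comm_group) auto
  have "PH X Y #>\<^bsub>hom_group C X Y\<^esub> f = PH X Y #>\<^bsub>hom_group C X Y\<^esub> g"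
    using repr_independence[of g "PH X Y" f] proj_homs_subgroup Hom_obj[OF assms(1)] assms
      stable_class_coset[OF assms(1)] by simp
  then show ?thesis using stable_class_coset stable_class_Hom assms by metis
qed

lemma stable_class_eq_iff:
  assumes "f \<in> Hom X Y" "g \<in> Hom X Y"
  shows "cls g = cls f \<longleftrightarrow> (\<exists>h\<in>PH X Y. g = h \<boxplus> f)"
  using stable_class_iff[OF assms(1)] stable_class_eqI[OF assms(1)] stable_class_self[OF assms(2)]
  by metis

lemma stable_simps [simp]:
  "obj (stable C) = obj C" "ident (stable C) X = cls (Id X)" "mzero (stable C) X Y = cls (Zero X Y)"
  by (simp_all add: stable_def)

lemma stable_src_tgt:
  assumes "f \<in> Hom X Y"
  shows "src (stable C) (cls f) = X" "tgt (stable C) (cls f) = Y"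
proof -
  have "(SOME g. g \<in> cls f) \<in> cls f" using stable_class_self[OF assms] by (rule someI)
  then have "(SOME g. g \<in> cls f) \<in> Hom X Y" by (rule stable_class_Hom[OF assms])
  then show "src (stable C) (cls f) = X" "tgt (stable C) (cls f) = Y"
    by (simp_all add: stable_def Hom_iff)
qed

lemma stable_hom_set: "hom_set (stable C) X Y = cls ` Hom X Y"
proof -
  have "cls f \<in> cls ` Hom X Y" if "f \<in> arr C" "src (stable C) (cls f) = X" "tgt (stable C) (cls f) = Y" for f
    using that stable_src_tgt[OF arr_Hom[OF that(1)]] by (auto simp: Hom_iff)
  then show ?thesis
    unfolding hom_set_def[of "stable C"]
    using stable_src_tgt by (fastforce simp: stable_def Hom_iff)
qed

lemma stable_cmp:
  assumes f: "f \<in> Hom X Y" and g: "g \<in> Hom Y Z"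
  shows "cls g \<cdot>\<^bsub>stable C\<^esub> cls f = cls (g \<cdot> f)"
proof -
  have eq: "cls (g' \<cdot> f') = cls (g \<cdot> f)" if f': "f' \<in> cls f" and g': "g' \<in> cls g" for f' g'
  proof -
    obtain h where h: "h \<in> PH X Y" "f' = h \<boxplus> f" using stable_class_iff[OF f] f' by blast
    obtain k where k: "k \<in> PH Y Z" "g' = k \<boxplus> g" using stable_class_iff[OF g] g' by blast
    have hk: "h \<in> Hom X Y" "k \<in> Hom Y Z" using h k proj_homs_Hom by blast+
    note [simp] = f[unfolded Hom_iff] g[unfolded Hom_iff] hk[unfolded Hom_iff]
    have "g' \<cdot> f' = (k \<cdot> h \<boxplus> (g \<cdot> h \<boxplus> k \<cdot> f)) \<boxplus> g \<cdot> f"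
      unfolding h(2) k(2) by (simp add: distrib add_ac)
    moreover have "k \<cdot> h \<boxplus> (g \<cdot> h \<boxplus> k \<cdot> f) \<in> PH X Z"
      by (intro proj_homs_add proj_homs_cmp_left[OF h(1)] proj_homs_cmp_right[OF k(1)] hk f g)
    moreover have "g \<cdot> f \<in> Hom X Z" "g' \<cdot> f' \<in> Hom X Z"
      using f g stable_class_Hom[OF f f'] stable_class_Hom[OF g g'] cmp_hom by blast+
    ultimately show ?thesis using stable_class_eq_iff by blast
  qed
  have "cls g \<cdot>\<^bsub>stable C\<^esub> cls f = (\<Union>g'\<in>cls g. \<Union>f'\<in>cls f. cls (g' \<cdot> f'))"
    by (simp add: stable_def)
  also have "\<dots> = (\<Union>g'\<in>cls g. \<Union>f'\<in>cls f. cls (g \<cdot> f))"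
    using eq by simp
  also have "\<dots> = cls (g \<cdot> f)" using stable_class_self[OF f] stable_class_self[OF g] by blast
  finally show ?thesis .
qed

lemma stable_hom_group:
  assumes "X \<in> obj C" "Y \<in> obj C"
  shows "hom_group (stable C) X Y = hom_group C X Y Mod PH X Y"
proof -
  interpret comm_group "hom_group C X Y" by (rule hom_comm_group[OF assms])
  have z: "Zero X Y \<in> Hom X Y" using assms by (simp add: Hom_iff)
  have 1: "cls (Zero X Y) = PH X Y"
    using coset_join2[OF _ proj_homs_subgroup[OF assms] proj_homs_zero[OF assms]] z
    by (simp add: stable_class_coset[OF z])
  have 2: "cls ` Hom X Y = carrier (hom_group C X Y Mod PH X Y)"
    unfolding carrier_FactGroup by (auto simp: stable_class_coset)
  have 3: "madd (stable C) = monoid.mult (hom_group C X Y Mod PH X Y)"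
    by (intro ext) (auto simp: stable_def set_mult_def)
  show ?thesis
    by (intro monoid.equality) (simp_all add: 1 2 3 stable_hom_set)
qed

lemma stable_madd:
  assumes f: "f \<in> Hom X Y" and g: "g \<in> Hom X Y"
  shows "madd (stable C) (cls f) (cls g) = cls (f \<boxplus> g)"
proof -
  have XY: "X \<in> obj C" "Y \<in> obj C" using Hom_obj[OF f] by auto
  interpret comm_group "hom_group C X Y" by (rule hom_comm_group[OF XY])
  have n: "PH X Y \<lhd> hom_group C X Y" using proj_homs_subgroup[OF XY] normal_iff_subgroup by blast
  have fg: "f \<boxplus> g \<in> Hom X Y" using f g by (simp add: Hom_iff)
  have "madd (stable C) (cls f) (cls g) = cls f <#>\<^bsub>hom_group C X Y\<^esub> cls g"
    by (auto simp: stable_def set_mult_def)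
  then show ?thesis
    using normal.rcos_sum[OF n, of f g] f g
    by (simp add: stable_class_coset[OF f] stable_class_coset[OF g] stable_class_coset[OF fg])
qed

text \<open>
  This makes the general facts on biproducts and on local objects available in the stable category,
  although its composition and its source and target maps are defined through representatives.
\<close>

lemma stable_preadditive: "preadditive_category (stable C)"
proof (rule preadditive_category.intro, unfold stable_hom_set stable_simps)
  fix F assume "F \<in> arr (stable C)"
  then obtain f where "f \<in> arr C" "F = cls f" by (auto simp: stable_def)
  then show "src (stable C) F \<in> obj C" "tgt (stable C) F \<in> obj C"
    using stable_src_tgt[OF arr_Hom] by simp_all
next
  fix X assume "X \<in> obj C"
  then show "cls (Id X) \<in> cls ` Hom X X" using ident_hom by blast
next
  fix F X Y G Z assume "F \<in> cls ` Hom X Y" "G \<in> cls ` Hom Y Z"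
  then show "G \<cdot>\<^bsub>stable C\<^esub> F \<in> cls ` Hom X Z" using stable_cmp cmp_hom by fastforce
next
  fix F W X G Y H Z assume "F \<in> cls ` Hom W X" "G \<in> cls ` Hom X Y" "H \<in> cls ` Hom Y Z"
  then obtain f g h where [simp]: "F = cls f" "G = cls g" "H = cls h"
    and fgh: "f \<in> Hom W X" "g \<in> Hom X Y" "h \<in> Hom Y Z" by blast
  show "(H \<cdot>\<^bsub>stable C\<^esub> G) \<cdot>\<^bsub>stable C\<^esub> F = H \<cdot>\<^bsub>stable C\<^esub> G \<cdot>\<^bsub>stable C\<^esub> F"
    using stable_cmp[OF fgh(1,2)] stable_cmp[OF fgh(2,3)] cmp_assoc[OF fgh]
      stable_cmp[OF fgh(1) cmp_hom[OF fgh(2,3)]] stable_cmp[OF cmp_hom[OF fgh(1,2)] fgh(3)] by simp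
next
  fix F X Y assume "F \<in> cls ` Hom X Y"
  then obtain f where f: "f \<in> Hom X Y" "F = cls f" by blast
  have "Id X \<in> Hom X X" "Id Y \<in> Hom Y Y" using Hom_obj[OF f(1)] ident_hom by auto
  then have "cls (Id Y) \<cdot>\<^bsub>stable C\<^esub> F = F \<and> F \<cdot>\<^bsub>stable C\<^esub> cls (Id X) = F"
    using stable_cmp f ident_left ident_right by metis
  then show "cls (Id Y) \<cdot>\<^bsub>stable C\<^esub> F = F" "F \<cdot>\<^bsub>stable C\<^esub> cls (Id X) = F" by auto
next
  fix X Y assume "X \<in> obj C" "Y \<in> obj C"
  then show "comm_group (hom_group (stable C) X Y)"
    using stable_hom_group comm_group.abelian_FactGroup[OF hom_comm_group proj_homs_subgroup] by simp
next
  fix F X Y G Z H assume "F \<in> cls ` Hom X Y" "G \<in> cls ` Hom Y Z" "H \<in> cls ` Hom Y Z"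
  then obtain f g h where [simp]: "F = cls f" "G = cls g" "H = cls h"
    and fgh: "f \<in> Hom X Y" "g \<in> Hom Y Z" "h \<in> Hom Y Z" by blast
  have gh: "g \<boxplus> h \<in> Hom Y Z" using fgh by (simp add: Hom_iff)
  show "madd (stable C) G H \<cdot>\<^bsub>stable C\<^esub> F = madd (stable C) (G \<cdot>\<^bsub>stable C\<^esub> F) (H \<cdot>\<^bsub>stable C\<^esub> F)"
    using stable_madd[OF fgh(2,3)] stable_cmp[OF fgh(1) gh] stable_cmp[OF fgh(1,2)]
      stable_cmp[OF fgh(1,3)] stable_madd[OF cmp_hom[OF fgh(1,2)] cmp_hom[OF fgh(1,3)]]
      cmp_madd_left[OF fgh] by simp
next
  fix F X Y G H Z assume "F \<in> cls ` Hom X Y" "G \<in> cls ` Hom X Y" "H \<in> cls ` Hom Y Z"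
  then obtain f g h where [simp]: "F = cls f" "G = cls g" "H = cls h"
    and fgh: "f \<in> Hom X Y" "g \<in> Hom X Y" "h \<in> Hom Y Z" by blast
  have fg: "f \<boxplus> g \<in> Hom X Y" using fgh by (simp add: Hom_iff)
  show "H \<cdot>\<^bsub>stable C\<^esub> madd (stable C) F G = madd (stable C) (H \<cdot>\<^bsub>stable C\<^esub> F) (H \<cdot>\<^bsub>stable C\<^esub> G)"
    using stable_madd[OF fgh(1,2)] stable_cmp[OF fg fgh(3)] stable_cmp[OF fgh(1,3)]
      stable_cmp[OF fgh(2,3)] stable_madd[OF cmp_hom[OF fgh(1,3)] cmp_hom[OF fgh(2,3)]]
      cmp_madd_right[OF fgh] by simp
qed

lemma stable_direct_sum:
  assumes "direct_sum C X [A, B]" shows "direct_sum (stable C) X [A, B]"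
proof -
  interpret S: preadditive_category "stable C" by (rule stable_preadditive)
  obtain i j p q where b: "biprod C X A B i j p q" using assms direct_sum_pair by blast
  have h: "i \<in> Hom A X" "j \<in> Hom B X" "p \<in> Hom X A" "q \<in> Hom X B" and
    e: "p \<cdot> i = Id A" "q \<cdot> j = Id B" "p \<cdot> j = Zero B A" "q \<cdot> i = Zero A B" "i \<cdot> p \<boxplus> j \<cdot> q = Id X"
    using b unfolding biprod_def by auto
  have "biprod (stable C) X A B (cls i) (cls j) (cls p) (cls q)"
    unfolding biprod_def stable_hom_set stable_simps
    using h e stable_cmp[OF h(1) h(3)] stable_cmp[OF h(2) h(4)] stable_cmp[OF h(2) h(3)]
      stable_cmp[OF h(1) h(4)] stable_cmp[OF h(3) h(1)] stable_cmp[OF h(4) h(2)]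
      stable_madd[OF cmp_hom[OF h(3) h(1)] cmp_hom[OF h(4) h(2)]] by simp
  then show ?thesis using S.direct_sum_pair by blast
qed

text \<open>
  A sum of two stable endomorphisms that is the stable identity lifts to a sum that is the
  identity: the difference, which factors through a projective object, is absorbed into one of
  the summands.
\<close>

lemma stable_local_obj:
  assumes L: "local_obj C L" and np: "L \<notin> projectives C"
  shows "local_obj (stable C) L"
proof -
  interpret S: preadditive_category "stable C" by (rule stable_preadditive)
  have o [simp]: "L \<in> obj C" using L by (simp add: local_obj_def)
  have id: "Id L \<in> Hom L L" and z: "Zero L L \<in> Hom L L" by (simp_all add: Hom_iff)
  have "cls (Id L) \<noteq> cls (Zero L L)"
  proof
    assume "cls (Id L) = cls (Zero L L)"
    then obtain h where h: "h \<in> PH L L" "Id L = h \<boxplus> Zero L L" using stable_class_eq_iff[OF z id] by blast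
    moreover have "h \<in> Hom L L" using h(1) proj_homs_Hom by blast
    ultimately have "Id L \<in> PH L L" by (simp add: Hom_iff)
    then have "\<exists>P\<in>projectives C. retract C L P" unfolding proj_homs_def retract_def by force
    then show False using np retract_projective by blast
  qed
  moreover have "iso_arr (stable C) F \<or> iso_arr (stable C) G"
    if F: "F \<in> hom_set (stable C) L L" and G: "G \<in> hom_set (stable C) L L"
      and FG: "madd (stable C) F G = cls (Id L)" for F G
  proof -
    have lift: "iso_arr (stable C) (cls f)" if f: "f \<in> Hom L L" and iso: "iso_arr C f" for f
    proof -
      obtain g where g: "g \<in> Hom L L" "g \<cdot> f = Id L" "f \<cdot> g = Id L" using iso_arrD[OF iso f] by blast
      show ?thesis
        by (rule S.iso_arrI[of "cls f" L L "cls g"])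
          (use f g stable_cmp[OF f g(1)] stable_cmp[OF g(1) f] in \<open>auto simp: stable_hom_set\<close>)
    qed
    obtain f g where f: "f \<in> Hom L L" "F = cls f" and g: "g \<in> Hom L L" "G = cls g"
      using F G by (auto simp: stable_hom_set)
    have fg: "f \<boxplus> g \<in> Hom L L" using f g by (simp add: Hom_iff)
    have "cls (Id L) = cls (f \<boxplus> g)" using FG f g stable_madd by simp
    then obtain h where h: "h \<in> PH L L" "Id L = h \<boxplus> (f \<boxplus> g)" using stable_class_eq_iff[OF fg id] by blast
    have hL: "h \<in> Hom L L" using h proj_homs_Hom by blast
    note [simp] = f(1)[unfolded Hom_iff] g(1)[unfolded Hom_iff] hL[unfolded Hom_iff]
    have hg: "h \<boxplus> g \<in> Hom L L" by (simp add: Hom_iff)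
    have "f \<boxplus> (h \<boxplus> g) = Id L" unfolding h(2) by (rule add_left_commute) simp_all
    then have "iso_arr C f \<or> iso_arr C (h \<boxplus> g)" using L f(1) hg unfolding local_obj_def by blast
    moreover have "cls (h \<boxplus> g) = cls g" using stable_class_eq_iff[OF g(1) hg] h(1) by blast
    ultimately show ?thesis using lift[OF f(1)] lift[OF hg] f(2) g(2) by auto
  qed
  ultimately show ?thesis unfolding local_obj_def by simp
qed

end


section \<open>The opposite category\<close>

lemma opposite_simps [simp]:
  "obj (opposite C) = obj C" "arr (opposite C) = arr C" "src (opposite C) = tgt C"
  "tgt (opposite C) = src C" "ident (opposite C) = ident C"
  "g \<cdot>\<^bsub>opposite C\<^esub> f = f \<cdot>\<^bsub>C\<^esub> g" "madd (opposite C) = madd C"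
  "mzero (opposite C) X Y = mzero C Y X"
  by (simp_all add: opposite_def)

lemma opposite_opposite [simp]: "opposite (opposite C) = C"
  by (simp add: opposite_def)

lemma opposite_hom_set [simp]: "hom_set (opposite C) X Y = hom_set C Y X"
  by (auto simp: hom_set_def)

lemma opposite_hom_group [simp]: "hom_group (opposite C) X Y = hom_group C Y X"
  by (simp add: hom_group_def)

lemma opposite_monic_epic [simp]:
  "monic (opposite C) f = epic C f" "epic (opposite C) f = monic C f"
  by (simp_all add: monic_def epic_def)

lemma opposite_kernel_cokernel [simp]:
  "is_kernel (opposite C) k f = is_cokernel C k f" "is_cokernel (opposite C) k f = is_kernel C k f"
  by (simp_all add: is_kernel_def is_cokernel_def)

lemma opposite_isomorphic_obj [simp]: "isomorphic_obj (opposite C) X Y = isomorphic_obj C X Y"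
  unfolding isomorphic_obj_def by auto

lemma opposite_iso_arr [simp]: "iso_arr (opposite C) f = iso_arr C f"
  unfolding iso_arr_def by auto

lemma opposite_retract [simp]: "retract (opposite C) X M = retract C X M"
  unfolding retract_def by auto

lemma opposite_zero_obj [simp]: "zero_obj (opposite C) Z = zero_obj C Z"
  unfolding zero_obj_def by auto

lemma opposite_local_obj [simp]: "local_obj (opposite C) X = local_obj C X"
  unfolding local_obj_def by simp

lemma opposite_projectives [simp]: "projectives (opposite C) = injectives C"
  by (simp add: projectives_def injectives_def)

lemma opposite_injectives [simp]: "injectives (opposite C) = projectives C"
  by (simp add: projectives_def injectives_def)

lemma direct_sum_imp_opposite:
  assumes "direct_sum C X Ys" shows "direct_sum (opposite C) X Ys"
proof -
  obtain \<iota> \<pi> where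
    "\<forall>k<length Ys. \<iota> k \<in> hom_set C (Ys ! k) X \<and> \<pi> k \<in> hom_set C X (Ys ! k)"
    "\<forall>j<length Ys. \<forall>k<length Ys.
       \<pi> j \<cdot>\<^bsub>C\<^esub> \<iota> k = (if j = k then ident C (Ys ! k) else mzero C (Ys ! k) (Ys ! j))"
    "finprod (hom_group C X X) (\<lambda>k. \<iota> k \<cdot>\<^bsub>C\<^esub> \<pi> k) {..<length Ys} = ident C X"
    using assms unfolding direct_sum_def by blast
  then show ?thesis
    using assms unfolding direct_sum_def
    by (intro conjI exI[of _ \<pi>] exI[of _ \<iota>]) auto
qed

lemma opposite_direct_sum [simp]: "direct_sum (opposite C) X Ys = direct_sum C X Ys"
  using direct_sum_imp_opposite[of C] direct_sum_imp_opposite[of "opposite C"] by auto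

lemma opposite_preadditive_category:
  assumes "preadditive_category C" shows "preadditive_category (opposite C)"
proof -
  interpret preadditive_category C by fact
  show ?thesis
    by (rule preadditive_category.intro)
      (simp_all add: ident_hom cmp_hom cmp_assoc ident_left ident_right hom_comm_group
        cmp_madd_left cmp_madd_right)
qed

lemma opposite_abelian_category:
  assumes "abelian_category C" shows "abelian_category (opposite C)"
proof -
  interpret abelian_category C by fact
  interpret O: preadditive_category "opposite C"
    by (rule opposite_preadditive_category) unfold_locales
  show ?thesis
    by unfold_locales
      (simp_all add: ex_zero_obj ex_direct_sum ex_kernel ex_cokernel monic_normal epic_normal)
qed

section \<open>Frobenius categories and Igusa-Todorov dimensions\<close>

text \<open>An infimum of extended naturals is attained unless the set is empty, where it is \<open>\<infinity>\<close>.\<close>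

lemma phi_eq_0_iff:
  "phi C M = 0 \<longleftrightarrow> (\<forall>m. Omega C \<in> iso (Omega_image C m M) (Omega_image C (Suc m) M))"
proof -
  let ?S = "{k. \<forall>m\<ge>k. Omega C \<in> iso (Omega_image C m M) (Omega_image C (Suc m) M)}"
  have "Inf (enat ` ?S) = 0 \<longleftrightarrow> 0 \<in> ?S"
  proof
    assume z: "Inf (enat ` ?S) = 0"
    have "enat ` ?S \<noteq> {}"
    proof
      assume "enat ` ?S = {}"
      with z show False unfolding Inf_enat_def by simp
    qed
    then have "Inf (enat ` ?S) \<in> enat ` ?S"
      unfolding Inf_enat_def using LeastI_ex[of "\<lambda>x. x \<in> enat ` ?S"] by (simp only: if_False) blast
    then show "0 \<in> ?S" unfolding z by (auto simp: zero_enat_def)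
  next
    assume "0 \<in> ?S"
    then have "Inf (enat ` ?S) \<le> enat 0" by (intro Inf_lower imageI)
    then show "Inf (enat ` ?S) = 0" by (simp add: zero_enat_def[symmetric])
  qed
  then show ?thesis unfolding phi_def by simp
qed

lemma phi_dim_eq_0_iff: "phi_dim C = 0 \<longleftrightarrow> (\<forall>M\<in>obj C. phi C M = 0)"
proof
  assume "phi_dim C = 0"
  then have "phi C M \<le> 0" if "M \<in> obj C" for M
    using that unfolding phi_dim_def by (metis SUP_upper)
  then show "\<forall>M\<in>obj C. phi C M = 0" by simp
next
  assume "\<forall>M\<in>obj C. phi C M = 0"
  then have "phi_dim C \<le> 0" unfolding phi_dim_def by (intro SUP_least) simp
  then show "phi_dim C = 0" by simp
qed

lemma phi_eq_0_imp_inj_on: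
  assumes "phi C M = 0" shows "inj_on (Omega C) (K_span C M)"
  using assms[unfolded phi_eq_0_iff, rule_format, of 0]
  by (simp add: iso_def bij_betw_def Omega_image_def)

lemma (in enough_projectives_category) phi_dim_eq_0_if_Omega_inj:
  assumes inj: "inj_on (Omega C) (carrier (K_group C))" shows "phi_dim C = 0"
proof -
  interpret K: comm_group "K_group C" by (rule K_group_comm_group)
  have "Omega C \<in> iso (Omega_image C m M) (Omega_image C (Suc m) M)" for m M
  proof -
    have "K_span C M \<subseteq> carrier (K_group C)"
      unfolding K_span_def by (rule K.generate_incl) (auto simp: indecomposable_def)
    then have sub: "(Omega C ^^ m) ` K_span C M \<subseteq> carrier (K_group C)"
    proof (induction m)
      case (Suc m)
      then show ?case using hom_in_carrier[OF Omega_hom] by auto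
    qed simp
    show ?thesis
      using inj_on_subset[OF inj sub] sub hom_mult[OF Omega_hom]
      unfolding iso_def hom_def Omega_image_def bij_betw_def by (auto simp: image_comp subset_iff)
  qed
  then show ?thesis unfolding phi_dim_eq_0_iff phi_eq_0_iff by blast
qed

text \<open>
  When projective and injective objects agree, an exact sequence that defines a syzygy defines a
  cosyzygy as well, so the two endomorphisms of the common group of stable classes are mutually
  inverse.
\<close>

lemma frobenius_phi_dim:
  assumes "enough_projectives_category C" "enough_projectives_category (opposite C)"
    and eq: "projectives C = injectives C"
  shows "phi_dim C = 0"
proof -
  interpret enough_projectives_category C by fact
  interpret O: enough_projectives_category "opposite C" by fact
  interpret K: comm_group "K_group C" by (rule K_group_comm_group)
  have ic: "iso_class (opposite C) = iso_class C" by (intro ext) (simp add: iso_class_def)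
  have K: "K_group (opposite C) = K_group C"
    by (simp add: K_group_def K_free_def K_relations_def ic eq)
  have Kc: "K_class (opposite C) = K_class C"
    by (intro ext) (simp add: K_class_def K_free_def K_relations_def ic eq)
  have inv: "Omega (opposite C) (Omega C (K_class C M)) = K_class C M" if M: "M \<in> obj C" for M
  proof -
    obtain N where N: "is_syzygy C M N" using ex_syzygy[OF enough M] by blast
    then obtain P p i where p: "P \<in> projectives C" "p \<in> Hom P M" "i \<in> Hom N P" "epic C p" "is_kernel C i p"
      unfolding is_syzygy_def by blast
    have "is_syzygy (opposite C) N M"
      by (rule O.is_syzygyI[of P i N p M])
        (use p eq kernel_monic[OF p(5)] epic_cokernel_of_kernel[OF p(4,5,2,3)] in simp_all)
    then show ?thesis using O.Omega_syzygy Omega_syzygy[OF N] by (simp add: Kc)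
  qed
  have hom: "Omega (opposite C) \<circ> Omega C \<in> hom (K_group C) (K_group C)"
    using hom_compose[OF Omega_hom] O.Omega_hom by (simp add: K)
  have "Omega (opposite C) (Omega C x) = x" if "x \<in> carrier (K_group C)" for x
    using K_group_hom_eq[OF hom _ K.is_group _ that, of "\<lambda>x. x"] inv by (simp add: hom_def)
  then show ?thesis by (intro phi_dim_eq_0_if_Omega_inj inj_on_inverseI)
qed

locale ks_enough_projectives_category = ks_category + enough_projectives_category
begin

text \<open>
  Decompose \<open>X\<close> into local objects. Projective ones have trivial class, and the others are
  indecomposable in the stable category, where they remain summands of \<open>M\<close>.
\<close>

lemma K_class_in_K_span:
  assumes "retract C X M" shows "K_class C X \<in> K_span C M"
proof -
  have "X \<in> obj C" using retract_obj[OF assms] by simp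
  then show ?thesis using assms
  proof (induction rule: decomposition_induct)
    case (zero Z)
    then show ?case
      using K_class_projective zero_projective by (simp add: K_span_def generate.one)
  next
    case (sum X Y K)
    have r: "retract C Y M" "retract C K M"
      using direct_sum_retracts[OF sum.hyps(1)] sum.prems retract_trans by blast+
    have "K_class C Y \<in> K_span C M"
    proof (cases "Y \<in> projectives C")
      case True
      then show ?thesis using K_class_projective by (simp add: K_span_def generate.one)
    next
      case False
      interpret S: preadditive_category "stable C" by (rule stable_preadditive)
      have "indecomposable (stable C) Y"
        by (rule S.local_obj_indecomposable[OF stable_local_obj[OF sum.hyps(2) False]])
      moreover have "direct_summand (stable C) Y M"
        unfolding direct_summand_def using retract_direct_sum[OF r(1)] stable_direct_sum by blast
      ultimately show ?thesis unfolding K_span_def by (blast intro: generate.incl)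
    qed
    moreover have "K_class C K \<in> K_span C M" using sum.IH r(2) by blast
    ultimately show ?case
      using K_class_direct_sum[OF sum.hyps(1)] by (simp add: K_span_def generate.eng)
  qed
qed

text \<open>Both classes lie in the span of \<open>X \<oplus> Y\<close>, on which \<open>\<Omega>\<close> is injective.\<close>

lemma K_class_eq_if_common_syzygy:
  assumes "phi_dim C = 0" "is_syzygy C X N" "is_syzygy C Y N"
  shows "K_class C X = K_class C Y"
proof -
  obtain M where M: "direct_sum C M [X, Y]" using ex_direct_sum assms syzygy_obj by blast
  then have "phi C M = 0"
    using assms(1)[unfolded phi_dim_eq_0_iff] direct_sum_obj by blast
  then have "inj_on (Omega C) (K_span C M)" by (rule phi_eq_0_imp_inj_on)
  moreover have "K_class C X \<in> K_span C M" "K_class C Y \<in> K_span C M"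
    using direct_sum_retracts[OF M] K_class_in_K_span by auto
  moreover have "Omega C (K_class C X) = Omega C (K_class C Y)"
    using Omega_syzygy[OF assms(2)] Omega_syzygy[OF assms(3)] by (rule trans[OF _ sym])
  ultimately show ?thesis by (blast dest: inj_onD)
qed

lemma local_retract_transfer:
  assumes "K_class C X = K_class C Y" "X \<in> obj C" "Y \<in> obj C"
    "local_obj C L" "L \<notin> projectives C" "retract C L Y"
  shows "retract C L X"
proof -
  obtain m n where mn: "ks_mult C L X m" "ks_mult C L Y n" using ex_ks_mult assms(2,3) by blast
  have "0 < n" by (rule ks_mult_local_retract[OF mn(2) assms(4,6)])
  then have "0 < m" using ks_mult_eq_of_K_class_eq[OF assms(4,5) mn assms(2,3,1)] by simp
  then show ?thesis by (rule ks_mult_retract[OF mn(1)])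
qed

end

text \<open>
  Embed a projective object \<open>P\<close> into an injective object \<open>I\<close> with cokernel \<open>Q\<close>. As \<open>P\<close> is
  projective, \<open>I\<close> and \<open>Q\<close> have a common syzygy, hence the same class. So a local summand of \<open>Q\<close>
  is a summand of \<open>I\<close>, by comparing multiplicities if it is not projective, and by lifting along
  \<open>I \<rightarrow> Q\<close> if it is. Hence \<open>Q\<close> is injective, and the cosyzygy of \<open>P\<close> has trivial class. By the
  dual hypothesis \<open>P\<close> has trivial class in the group of the opposite category, and is injective.
\<close>

lemma projectives_subset_injectives:
  assumes "ks_enough_projectives_category C" "ks_enough_projectives_category (opposite C)"
    and phi: "phi_dim C = 0" "phi_dim (opposite C) = 0"
  shows "projectives C \<subseteq> injectives C"
proof
  interpret ks_enough_projectives_category C by fact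
  interpret O: ks_enough_projectives_category "opposite C" by fact
  fix P assume P: "P \<in> projectives C"
  have oP: "P \<in> obj C" by (rule projective_obj[OF P])
  obtain I i where I: "I \<in> injectives C" "i \<in> Hom P I" "monic C i"
    using O.enough oP unfolding enough_projectives_def by auto
  obtain q where cok: "is_cokernel C q i" using ex_cokernel I(2) by (auto simp: Hom_iff)
  define Q where "Q = tgt C q"
  have q: "q \<in> Hom I Q" using cok I(2) unfolding is_cokernel_def Hom_iff Q_def by simp
  have epi: "epic C q" using O.kernel_monic[of q i] cok by simp
  have ker: "is_kernel C i q"
    using O.epic_cokernel_of_kernel[of i q I P Q] I(2,3) cok q by simp
  have oIQ: "I \<in> obj C" "Q \<in> obj C" using Hom_obj[OF q] by auto
  obtain N where N: "is_syzygy C Q N" using ex_syzygy[OF enough oIQ(2)] by blast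
  have "is_syzygy C I N" by (rule syzygy_of_projective_extension[OF P q epi ker I(2) N])
  then have IQ: "K_class C I = K_class C Q" by (rule K_class_eq_if_common_syzygy[OF phi(1) _ N])
  have Q: "Q \<in> projectives (opposite C)"
  proof (rule O.projective_if_local_retracts)
    fix L assume "local_obj (opposite C) L" "retract (opposite C) L Q"
    then have L: "local_obj C L" "retract C L Q" by simp_all
    have "retract C L I"
    proof (cases "L \<in> projectives C")
      case True
      obtain s r where sr: "s \<in> Hom L Q" "r \<in> Hom Q L" "r \<cdot>\<^bsub>C\<^esub> s = Id L"
        using L(2) unfolding retract_def by blast
      obtain t where t: "t \<in> Hom L I" "q \<cdot>\<^bsub>C\<^esub> t = s" using projective_lift[OF True epi q sr(1)] by blast
      have "(r \<cdot>\<^bsub>C\<^esub> q) \<cdot>\<^bsub>C\<^esub> t = Id L" using cmp_assoc[OF t(1) q sr(2)] t(2) sr(3) by simp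
      then show ?thesis unfolding retract_def using t(1) cmp_hom[OF q sr(2)] by blast
    next
      case False
      then show ?thesis using local_retract_transfer[OF IQ oIQ L(1) False L(2)] by simp
    qed
    then show "L \<in> projectives (opposite C)" using O.retract_projective[of L I] I(1) by simp
  qed (simp add: oIQ)
  have PQ: "is_syzygy (opposite C) P Q"
    by (rule O.is_syzygyI[of I i P q Q]) (use I q cok in simp_all)
  obtain Z where Z: "zero_obj C Z" using ex_zero_obj by blast
  have oZ: "Z \<in> obj C" using Z by (simp add: zero_obj_def)
  have "is_syzygy (opposite C) Z Q" by (rule O.syzygy_of_zero[OF _ Q]) (simp add: Z)
  then have ZP: "K_class (opposite C) Z = K_class (opposite C) P"
    by (rule O.K_class_eq_if_common_syzygy[OF phi(2) _ PQ])
  have "P \<in> projectives (opposite C)"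
  proof (rule O.projective_if_local_retracts)
    fix L assume L: "local_obj (opposite C) L" "retract (opposite C) L P"
    show "L \<in> projectives (opposite C)"
    proof (rule ccontr)
      assume "L \<notin> projectives (opposite C)"
      then have "retract (opposite C) L Z"
        using O.local_retract_transfer[OF ZP _ _ L(1) _ L(2)] oZ oP by simp
      then show False using L(1) Z O.retract_zero[of L Z] O.local_obj_not_zero[of L] by simp
    qed
  qed (simp add: oP)
  then show "P \<in> injectives C" by simp
qed

theorem theorem3p4:
  fixes C :: "('o, 'm) preadd_cat"
  assumes "abelian_category C"
    and "krull_schmidt C"
    and "enough_projectives C"
    and "enough_injectives C"
  shows "frobenius_category C \<longleftrightarrow> phi_dim C = 0 \<and> cophi_dim C = 0"
proof -
  interpret abelian_category C by fact
  interpret O: abelian_category "opposite C" by (rule opposite_abelian_category[OF assms(1)])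
  have dec: "\<exists>Ys. direct_sum C X Ys \<and> (\<forall>Y\<in>set Ys. local_obj C Y)" if X: "X \<in> obj C" for X
  proof -
    obtain Ys where Ys: "direct_sum C X Ys" "\<forall>Y\<in>set Ys. local_ring (End_ring C Y)"
      using assms(2) X unfolding krull_schmidt_def by blast
    moreover have "set Ys \<subseteq> obj C" using Ys(1) by (simp add: direct_sum_def)
    ultimately show ?thesis using local_ring_imp_local_obj by blast
  qed
  have C: "ks_enough_projectives_category C"
    by unfold_locales (simp_all add: dec assms(3))
  have O: "ks_enough_projectives_category (opposite C)"
    using assms(4)
    by unfold_locales (auto simp: dec enough_projectives_def enough_injectives_def)
  have epC: "enough_projectives_category C" "enough_projectives_category (opposite C)"
    using C O by (auto simp: ks_enough_projectives_category_def)
  show ?thesis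
  proof
    assume "frobenius_category C"
    then have "projectives C = injectives C" by (simp add: frobenius_category_def)
    then show "phi_dim C = 0 \<and> cophi_dim C = 0"
      using frobenius_phi_dim[of C] frobenius_phi_dim[of "opposite C"] epC
      by (simp add: cophi_dim_def)
  next
    assume "phi_dim C = 0 \<and> cophi_dim C = 0"
    then have "projectives C \<subseteq> injectives C" "injectives C \<subseteq> projectives C"
      using projectives_subset_injectives[of C] projectives_subset_injectives[of "opposite C"] C O
      by (simp_all add: cophi_dim_def)
    then show "frobenius_category C" using assms by (auto simp: frobenius_category_def)
  qed
qed

end
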